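(* Let $(M^m,g)$ be a Riemannian manifold, let $\phi:(M^m,g)\to\mathbb{S}^n$ be a smooth map and let $i:\mathbb{S}^n\to\mathbb{R}^{n+1}$ be the standard isometric embedding. Then $\phi$ is a biharmonic map if and only if the vector function $\varphi=i\circ\phi:(M^m,g)\to\mathbb{R}^{n+1}$ solves the PDE $$\tau_2(\varphi)+2|d\varphi|^2\tau(\varphi)+\left(-\Delta|d\varphi|^2+2\operatorname{div}\theta^\sharp-|\tau(\varphi)|^2+2|d\varphi|^4\right)\varphi+2\,d\varphi\left(\operatorname{grad}|d\varphi|^2\right)=0,$$ where $\theta$ is the $1$-form on $M$ defined by $\theta(X)=\langle d\varphi(X),\tau(\varphi)\rangle$ and $\theta^\sharp$ is the vector field on $M$ associated to $\theta$ by the musical isomorphism.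
   Context: $\mathbb{S}^n$ is the unit Euclidean sphere in $\mathbb{R}^{n+1}$ with its round metric. For a smooth map $\phi:(M,g)\to(N,h)$ between Riemannian manifolds, the tension field is $\tau(\phi)=\operatorname{trace}\nabla d\phi$ and the bitension field is $\tau_2(\phi)=-\Delta\tau(\phi)-\operatorname{trace}R^N(d\phi(\cdot),\tau(\phi))d\phi(\cdot)$, where $\Delta\sigma=-\operatorname{trace}_g\nabla^2\sigma$ is the rough Laplacian on sections of $\phi^{-1}TN$ and $R(X,Y)Z=\nabla_X\nabla_YZ-\nabla_Y\nabla_XZ-\nabla_{[X,Y]}Z$. The same sign convention $\Delta=-\operatorname{trace}\nabla^2$ is used for functions on $M$; in particular, for $\varphi$ with values in $\mathbb{R}^{n+1}$, $\tau(\varphi)=-\Delta\varphi$ and $\tau_2(\varphi)=\Delta\Delta\varphi$. $|d\varphi|$ is the Hilbert–Schmidt norm. The map $\phi$ is biharmonic if $\tau_2(\phi)=0$. (With $d\phi(X)$ identified with $d\varphi(X)$, one also has $\theta(X)=\langle d\phi(X),\tau(\phi)\rangle$.) *)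

theory Defs
  imports "HOL-Analysis.Analysis"
begin

primrec Ck_on :: "nat \<Rightarrow> ('a::real_normed_vector \<Rightarrow> 'b::real_normed_vector) \<Rightarrow> 'a set \<Rightarrow> bool" where
  "Ck_on 0 f S \<longleftrightarrow> continuous_on S f"
| "Ck_on (Suc k) f S \<longleftrightarrow>
     (\<forall>x\<in>S. f differentiable (at x)) \<and>
     (\<forall>v. Ck_on k (\<lambda>x. frechet_derivative f (at x) v) S)"

text \<open>Meaningful on open sets \<open>S\<close> only, since the derivatives are two-sided.\<close>
definition smooth_on :: "('a::real_normed_vector \<Rightarrow> 'b::real_normed_vector) \<Rightarrow> 'a set \<Rightarrow> bool" where
  "smooth_on f S \<longleftrightarrow> (\<forall>k. Ck_on k f S)"


section \<open>Riemannian manifolds\<close>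

text \<open>A chart is a pair of its domain and its coordinate map; the values of the coordinate map
  outside the domain are irrelevant.\<close>
type_synonym ('a, 'm) chart = "'a set \<times> ('a \<Rightarrow> real^'m)"

abbreviation chart_dom :: "('a, 'm) chart \<Rightarrow> 'a set" where
  "chart_dom c \<equiv> fst c"

abbreviation coords :: "('a, 'm) chart \<Rightarrow> 'a \<Rightarrow> real^'m" where
  "coords c \<equiv> snd c"

definition chart_inv :: "('a, 'm) chart \<Rightarrow> real^'m \<Rightarrow> 'a" where
  "chart_inv c = inv_into (chart_dom c) (coords c)"

definition is_chart :: "'a topology \<Rightarrow> ('a, 'm::finite) chart \<Rightarrow> bool" where
  "is_chart X c \<longleftrightarrow>
     openin X (chart_dom c) \<and> open (coords c ` chart_dom c) \<and>
     homeomorphic_map (subtopology X (chart_dom c)) (top_of_set (coords c ` chart_dom c)) (coords c)"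

text \<open>\<open>Dch c f p v\<close> is the derivative of a vector-valued function \<open>f\<close> at the point \<open>p\<close> in the
  direction of the tangent vector whose components in the chart \<open>c\<close> are \<open>v\<close>, and \<open>\<partial> c i f p\<close> is
  the partial derivative with respect to the \<open>i\<close>-th coordinate of \<open>c\<close>.\<close>
definition Dch :: "('a, 'm::finite) chart \<Rightarrow> ('a \<Rightarrow> 'v::real_normed_vector) \<Rightarrow> 'a \<Rightarrow> real^'m \<Rightarrow> 'v" where
  "Dch c f p v = frechet_derivative (f \<circ> chart_inv c) (at (coords c p)) v"

abbreviation pderiv_chart ::
    "('a, 'm::finite) chart \<Rightarrow> 'm \<Rightarrow> ('a \<Rightarrow> 'v::real_normed_vector) \<Rightarrow> 'a \<Rightarrow> 'v"  (\<open>\<partial>\<close>) where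
  "\<partial> c i f p \<equiv> Dch c f p (axis i 1)"

text \<open>Tensor fields are given by their components in the charts; \<open>rmetric M c p\<close> is the matrix of
  the metric at \<open>p\<close> with respect to the coordinate frame of \<open>c\<close>.\<close>
record ('a, 'm) riem_mfd =
  mtop :: "'a topology"
  atlas :: "('a, 'm) chart set"
  rmetric :: "('a, 'm) chart \<Rightarrow> 'a \<Rightarrow> real^'m^'m"

definition riemannian_manifold :: "('a, 'm::finite) riem_mfd \<Rightarrow> bool" where
  "riemannian_manifold M \<longleftrightarrow>
     Hausdorff_space (mtop M) \<and> second_countable (mtop M) \<and>
     (\<forall>c\<in>atlas M. is_chart (mtop M) c) \<and>
     (\<Union>c\<in>atlas M. chart_dom c) = topspace (mtop M) \<and>
     (\<forall>c\<in>atlas M. \<forall>c'\<in>atlas M.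
        smooth_on (coords c' \<circ> chart_inv c) (coords c ` (chart_dom c \<inter> chart_dom c'))) \<and>
     (\<forall>c\<in>atlas M. smooth_on (rmetric M c \<circ> chart_inv c) (coords c ` chart_dom c)) \<and>
     (\<forall>c\<in>atlas M. \<forall>p\<in>chart_dom c.
        transpose (rmetric M c p) = rmetric M c p \<and>
        (\<forall>v. v \<noteq> 0 \<longrightarrow> v \<bullet> (rmetric M c p *v v) > 0)) \<and>
     (\<forall>c\<in>atlas M. \<forall>c'\<in>atlas M. \<forall>p\<in>chart_dom c \<inter> chart_dom c'. \<forall>v w.
        v \<bullet> (rmetric M c p *v w) =
        Dch c (coords c') p v \<bullet> (rmetric M c' p *v Dch c (coords c') p w))"

definition smooth_map :: "('a, 'm::finite) riem_mfd \<Rightarrow> ('b, 'n::finite) riem_mfd \<Rightarrow> ('a \<Rightarrow> 'b) \<Rightarrow> bool" where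
  "smooth_map M N \<phi> \<longleftrightarrow>
     continuous_map (mtop M) (mtop N) \<phi> \<and>
     (\<forall>c\<in>atlas M. \<forall>d\<in>atlas N.
        smooth_on (coords d \<circ> \<phi> \<circ> chart_inv c) (coords c ` (chart_dom c \<inter> \<phi> -` chart_dom d)))"


subsection \<open>Euclidean space and the unit sphere\<close>

definition std_chart :: "(real^'k, 'k::finite) chart" where
  "std_chart = (UNIV, \<lambda>x. x)"

definition euclidean_mfd :: "(real^'k, 'k::finite) riem_mfd" where
  "euclidean_mfd = \<lparr>mtop = euclidean, atlas = {std_chart}, rmetric = (\<lambda>c p. mat 1)\<rparr>"

text \<open>The unit sphere as a Riemannian submanifold: it carries all charts whose inverses are smooth
  immersions into the ambient space, and the metric induced by the Euclidean inner product. The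
  intended use is with \<open>CARD('k) = CARD('n) + 1\<close>.\<close>
definition sphere_mfd :: "(real^'k::finite, 'n::finite) riem_mfd" where
  "sphere_mfd =
     \<lparr>mtop = top_of_set (sphere 0 1),
      atlas = {c. is_chart (top_of_set (sphere 0 1)) c \<and>
                  smooth_on (chart_inv c) (coords c ` chart_dom c) \<and>
                  (\<forall>y\<in>coords c ` chart_dom c. inj (frechet_derivative (chart_inv c) (at y)))},
      rmetric = (\<lambda>c p. \<chi> a b. \<partial> c a (\<lambda>q. q) p \<bullet> \<partial> c b (\<lambda>q. q) p)\<rparr>"


section \<open>Levi-Civita connection and curvature\<close>

text \<open>In what follows vector fields, vectors and tensors are given by components in the chart \<open>c\<close>
  (of \<open>M\<close>) or \<open>d\<close> (of \<open>N\<close>) that is passed as an argument.\<close>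

definition inv_metric :: "('a, 'm::finite) riem_mfd \<Rightarrow> ('a, 'm) chart \<Rightarrow> 'a \<Rightarrow> real^'m^'m" where
  "inv_metric M c p = matrix_inv (rmetric M c p)"

text \<open>\<open>christoffel M c p k i j\<close> is \<open>\<Gamma>\<^sup>k\<^sub>i\<^sub>j\<close> at \<open>p\<close>.\<close>
definition christoffel :: "('a, 'm::finite) riem_mfd \<Rightarrow> ('a, 'm) chart \<Rightarrow> 'a \<Rightarrow> 'm \<Rightarrow> 'm \<Rightarrow> 'm \<Rightarrow> real" where
  "christoffel M c p k i j =
     (\<Sum>l\<in>UNIV. inv_metric M c p $ k $ l *
        (\<partial> c i (\<lambda>q. rmetric M c q $ j $ l) p + \<partial> c j (\<lambda>q. rmetric M c q $ i $ l) p
           - \<partial> c l (\<lambda>q. rmetric M c q $ i $ j) p)) / 2"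

definition christoffel_form ::
    "('a, 'm::finite) riem_mfd \<Rightarrow> ('a, 'm) chart \<Rightarrow> 'a \<Rightarrow> real^'m \<Rightarrow> real^'m \<Rightarrow> real^'m" where
  "christoffel_form M c p u v = (\<chi> k. \<Sum>i\<in>UNIV. \<Sum>j\<in>UNIV. christoffel M c p k i j * u $ i * v $ j)"

text \<open>\<open>\<nabla>\<^sub>X Y\<close>\<close>
definition levi_civita ::
    "('a, 'm::finite) riem_mfd \<Rightarrow> ('a, 'm) chart \<Rightarrow> ('a \<Rightarrow> real^'m) \<Rightarrow> ('a \<Rightarrow> real^'m) \<Rightarrow> 'a \<Rightarrow> real^'m" where
  "levi_civita M c X Y p = Dch c Y p (X p) + christoffel_form M c p (X p) (Y p)"

definition lie_bracket ::
    "('a, 'm::finite) chart \<Rightarrow> ('a \<Rightarrow> real^'m) \<Rightarrow> ('a \<Rightarrow> real^'m) \<Rightarrow> 'a \<Rightarrow> real^'m" where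
  "lie_bracket c X Y p = Dch c Y p (X p) - Dch c X p (Y p)"

definition curvature_op ::
    "('a, 'm::finite) riem_mfd \<Rightarrow> ('a, 'm) chart \<Rightarrow>
       ('a \<Rightarrow> real^'m) \<Rightarrow> ('a \<Rightarrow> real^'m) \<Rightarrow> ('a \<Rightarrow> real^'m) \<Rightarrow> 'a \<Rightarrow> real^'m" where
  "curvature_op M c X Y Z p =
     levi_civita M c X (levi_civita M c Y Z) p - levi_civita M c Y (levi_civita M c X Z) p
       - levi_civita M c (lie_bracket c X Y) Z p"

text \<open>The value of the curvature tensor on tangent vectors at \<open>p\<close>; by tensoriality it may be computed
  with any extensions to vector fields, here the ones with constant components.\<close>
definition curvature ::
    "('a, 'm::finite) riem_mfd \<Rightarrow> ('a, 'm) chart \<Rightarrow> 'a \<Rightarrow> real^'m \<Rightarrow> real^'m \<Rightarrow> real^'m \<Rightarrow> real^'m" where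
  "curvature M c p u v w = curvature_op M c (\<lambda>_. u) (\<lambda>_. v) (\<lambda>_. w) p"


section \<open>Differential operators on a Riemannian manifold\<close>

definition sharp :: "('a, 'm::finite) riem_mfd \<Rightarrow> ('a, 'm) chart \<Rightarrow> ('a \<Rightarrow> real^'m \<Rightarrow> real) \<Rightarrow> 'a \<Rightarrow> real^'m" where
  "sharp M c \<omega> p = inv_metric M c p *v (\<chi> i. \<omega> p (axis i 1))"

definition grad :: "('a, 'm::finite) riem_mfd \<Rightarrow> ('a, 'm) chart \<Rightarrow> ('a \<Rightarrow> real) \<Rightarrow> 'a \<Rightarrow> real^'m" where
  "grad M c f = sharp M c (Dch c f)"

definition divergence :: "('a, 'm::finite) riem_mfd \<Rightarrow> ('a, 'm) chart \<Rightarrow> ('a \<Rightarrow> real^'m) \<Rightarrow> 'a \<Rightarrow> real" where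
  "divergence M c X p = (\<Sum>i\<in>UNIV. levi_civita M c (\<lambda>_. axis i 1) X p $ i)"

definition trace_g ::
    "('a, 'm::finite) riem_mfd \<Rightarrow> ('a, 'm) chart \<Rightarrow> 'a \<Rightarrow> ('m \<Rightarrow> 'm \<Rightarrow> 'v::real_vector) \<Rightarrow> 'v" where
  "trace_g M c p B = (\<Sum>i\<in>UNIV. \<Sum>j\<in>UNIV. inv_metric M c p $ i $ j *\<^sub>R B i j)"

text \<open>\<open>- trace \<nabla>\<^sup>2 \<sigma>\<close> for sections \<open>\<sigma>\<close> of a vector bundle with connection, where \<open>D i\<close> is the
  covariant derivative along the \<open>i\<close>-th coordinate vector field.\<close>
definition conn_laplacian ::
    "('a, 'm::finite) riem_mfd \<Rightarrow> ('a, 'm) chart \<Rightarrow>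
       ('m \<Rightarrow> ('a \<Rightarrow> 'v::real_vector) \<Rightarrow> 'a \<Rightarrow> 'v) \<Rightarrow> ('a \<Rightarrow> 'v) \<Rightarrow> 'a \<Rightarrow> 'v" where
  "conn_laplacian M c D \<sigma> p =
     - trace_g M c p (\<lambda>i j. D i (D j \<sigma>) p - (\<Sum>k\<in>UNIV. christoffel M c p k i j *\<^sub>R D k \<sigma> p))"

definition laplacian :: "('a, 'm::finite) riem_mfd \<Rightarrow> ('a, 'm) chart \<Rightarrow> ('a \<Rightarrow> real) \<Rightarrow> 'a \<Rightarrow> real" where
  "laplacian M c = conn_laplacian M c (\<partial> c)"


section \<open>Tension and bitension field\<close>

text \<open>Sections of \<open>\<phi>\<^sup>-\<^sup>1TN\<close> are given by components in the chart \<open>d\<close> of \<open>N\<close>; the formulas are used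
  at points of \<open>chart_dom c \<inter> \<phi> -` chart_dom d\<close>.\<close>

definition differential ::
    "('a, 'm::finite) chart \<Rightarrow> ('b, 'n::finite) chart \<Rightarrow> ('a \<Rightarrow> 'b) \<Rightarrow> 'a \<Rightarrow> real^'m \<Rightarrow> real^'n" where
  "differential c d \<phi> = Dch c (coords d \<circ> \<phi>)"

text \<open>The pullback connection, along the \<open>i\<close>-th coordinate vector field.\<close>
definition pullback_conn ::
    "('b, 'n::finite) riem_mfd \<Rightarrow> ('a, 'm::finite) chart \<Rightarrow> ('b, 'n) chart \<Rightarrow> ('a \<Rightarrow> 'b) \<Rightarrow>
       'm \<Rightarrow> ('a \<Rightarrow> real^'n) \<Rightarrow> 'a \<Rightarrow> real^'n" where
  "pullback_conn N c d \<phi> i \<sigma> p =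
     \<partial> c i \<sigma> p + christoffel_form N d (\<phi> p) (differential c d \<phi> p (axis i 1)) (\<sigma> p)"

text \<open>\<open>(\<nabla>d\<phi>)(\<partial>\<^sub>i, \<partial>\<^sub>j) = \<nabla>\<^sup>\<phi>\<^sub>i (d\<phi> \<partial>\<^sub>j) - d\<phi> (\<nabla>\<^sub>i \<partial>\<^sub>j)\<close>\<close>
definition second_fundamental_form ::
    "('a, 'm::finite) riem_mfd \<Rightarrow> ('b, 'n::finite) riem_mfd \<Rightarrow> ('a, 'm) chart \<Rightarrow> ('b, 'n) chart \<Rightarrow>
       ('a \<Rightarrow> 'b) \<Rightarrow> 'a \<Rightarrow> 'm \<Rightarrow> 'm \<Rightarrow> real^'n" where
  "second_fundamental_form M N c d \<phi> p i j =
     pullback_conn N c d \<phi> i (\<lambda>q. differential c d \<phi> q (axis j 1)) p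
       - differential c d \<phi> p (levi_civita M c (\<lambda>_. axis i 1) (\<lambda>_. axis j 1) p)"

definition tension ::
    "('a, 'm::finite) riem_mfd \<Rightarrow> ('b, 'n::finite) riem_mfd \<Rightarrow> ('a, 'm) chart \<Rightarrow> ('b, 'n) chart \<Rightarrow>
       ('a \<Rightarrow> 'b) \<Rightarrow> 'a \<Rightarrow> real^'n" where
  "tension M N c d \<phi> p = trace_g M c p (second_fundamental_form M N c d \<phi> p)"

definition bitension ::
    "('a, 'm::finite) riem_mfd \<Rightarrow> ('b, 'n::finite) riem_mfd \<Rightarrow> ('a, 'm) chart \<Rightarrow> ('b, 'n) chart \<Rightarrow>
       ('a \<Rightarrow> 'b) \<Rightarrow> 'a \<Rightarrow> real^'n" where
  "bitension M N c d \<phi> p =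
     - conn_laplacian M c (pullback_conn N c d \<phi>) (tension M N c d \<phi>) p
     - trace_g M c p (\<lambda>i j. curvature N d (\<phi> p) (differential c d \<phi> p (axis i 1))
                              (tension M N c d \<phi> p) (differential c d \<phi> p (axis j 1)))"

text \<open>Vanishing of \<open>\<tau>\<^sub>2(\<phi>)\<close>, a section of \<open>\<phi>\<^sup>-\<^sup>1TN\<close>, means vanishing of its components in all charts.\<close>
definition biharmonic ::
    "('a, 'm::finite) riem_mfd \<Rightarrow> ('b, 'n::finite) riem_mfd \<Rightarrow> ('a \<Rightarrow> 'b) \<Rightarrow> bool" where
  "biharmonic M N \<phi> \<longleftrightarrow>
     (\<forall>c\<in>atlas M. \<forall>d\<in>atlas N. \<forall>p\<in>chart_dom c. \<phi> p \<in> chart_dom d \<longrightarrow> bitension M N c d \<phi> p = 0)"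

text \<open>The square \<open>|d\<phi>|\<^sup>2\<close> of the Hilbert--Schmidt norm.\<close>
definition hs_norm_sq ::
    "('a, 'm::finite) riem_mfd \<Rightarrow> ('b, 'n::finite) riem_mfd \<Rightarrow> ('a, 'm) chart \<Rightarrow> ('b, 'n) chart \<Rightarrow>
       ('a \<Rightarrow> 'b) \<Rightarrow> 'a \<Rightarrow> real" where
  "hs_norm_sq M N c d \<phi> p =
     trace_g M c p (\<lambda>i j. differential c d \<phi> p (axis i 1) \<bullet>
                            (rmetric N d (\<phi> p) *v differential c d \<phi> p (axis j 1)))"

end

theory Submission
  imports Defs
begin

text \<open>
  Composing with the inclusion of the sphere turns a section of \<open>\<phi>\<^sup>-\<^sup>1TS\<close> into a vector-valued function
  on \<open>M\<close>. This operation, written \<open>E (\<phi> p) (\<sigma> p)\<close> below, is injective in every fibre, and it takes the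
  bitension field of \<open>\<phi>\<close> exactly to the left-hand side of the equation (lemma \<open>pde_eq_E_bitension\<close>);
  the equivalence follows because the charts of the sphere cover it (\<open>sphere_chart_exists\<close>).

  Three facts about the round sphere carry the computation. The Gauss formula
  (\<open>gauss_formula_axis\<close>) shows that the pullback connection becomes
  \<open>\<partial>\<^sub>i \<sigma> + \<langle>\<partial>\<^sub>i \<phi>, \<sigma>\<rangle> \<phi>\<close>, that is, differentiation in the ambient space followed by tangential projection
  (\<open>E_pullback_connection\<close>). Applied twice in the sphere itself it yields the Gauss equation
  \<open>R(u,v)w = \<langle>v,w\<rangle> u - \<langle>u,w\<rangle> v\<close> (\<open>E_curvature\<close>). Finally \<open>\<langle>\<phi>, \<phi>\<rangle> = 1\<close> makes every \<open>\<partial>\<^sub>i \<phi>\<close> orthogonal to \<open>\<phi>\<close>.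

  Write \<open>L\<close> for the trace of the Hessian, \<open>t = L \<phi>\<close> for the tension field of the vector function and
  \<open>e = |d\<phi>|\<^sup>2\<close>. Projecting gives \<open>T = t + e \<phi>\<close> for the image of the tension field of \<open>\<phi>\<close>
  (\<open>E_tension\<close>), and \<open>\<langle>t, \<phi>\<rangle> = - e\<close>. Let \<open>\<delta> = div \<theta>\<^sup>\<sharp>\<close>; since the \<open>\<partial>\<^sub>i \<phi>\<close> are orthogonal to \<open>\<phi>\<close>, also
  \<open>\<theta>\<^sub>j = \<langle>\<partial>\<^sub>j \<phi>, T\<rangle>\<close>. Covariantly differentiating \<open>T\<close> twice and tracing gives
  \<open>L T + (\<delta> + trace \<langle>d\<phi>, dT\<rangle>) \<phi> + trace (\<theta>\<^sub>j \<partial>\<^sub>i \<phi>)\<close>. The curvature term subtracts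
  \<open>trace (\<theta>\<^sub>j \<partial>\<^sub>i \<phi>) - e T\<close>, and the product rule for \<open>\<delta>\<close> gives
  \<open>trace \<langle>d\<phi>, dT\<rangle> = \<delta> - \<langle>t, T\<rangle> = \<delta> - |t|\<^sup>2 + e\<^sup>2\<close>. So the bitension field becomes
  \<open>L T + e T + (2 \<delta> - |t|\<^sup>2 + e\<^sup>2) \<phi>\<close>, and expanding \<open>L (e \<phi>)\<close> by the product rule gives the claim.
\<close>

section \<open>Calculus of smooth functions\<close>

lemma differentiable_cong_on_open:
  assumes "open S" "x \<in> S" "\<And>y. y \<in> S \<Longrightarrow> f y = g y" "f differentiable at x"
  shows "g differentiable at x" "frechet_derivative g (at x) = frechet_derivative f (at x)"
proof -
  have "(f has_derivative frechet_derivative f (at x)) (at x)"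
    using assms(4) frechet_derivative_works by blast
  hence *: "(g has_derivative frechet_derivative f (at x)) (at x)"
    using has_derivative_transform_within_open[of f _ x UNIV S g] assms(1-3) by auto
  show "g differentiable at x" using * differentiable_def by blast
  show "frechet_derivative g (at x) = frechet_derivative f (at x)"
    using frechet_derivative_at[OF *] by simp
qed

text \<open>On an open set the derivatives at a point depend only on nearby values. This is what allows to
  replace a function by a formula that holds only inside a chart.\<close>
lemma Ck_on_cong:
  assumes "open S" "\<And>y. y \<in> S \<Longrightarrow> f y = g y" "Ck_on k f S"
  shows "Ck_on k g S"
  using assms(2,3)
proof (induction k arbitrary: f g)
  case 0
  then show ?case by (simp cong: continuous_on_cong)
next
  case (Suc k)
  have d: "f differentiable at x" if "x \<in> S" for x using Suc.prems(2) that by simp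
  have "Ck_on k (\<lambda>x. frechet_derivative g (at x) v) S" for v
  proof (rule Suc.IH)
    show "frechet_derivative f (at y) v = frechet_derivative g (at y) v" if "y \<in> S" for y
      using differentiable_cong_on_open(2)[OF assms(1) that Suc.prems(1) d[OF that]] by simp
    show "Ck_on k (\<lambda>y. frechet_derivative f (at y) v) S" using Suc.prems(2) by simp
  qed
  then show ?case
    using differentiable_cong_on_open(1)[OF assms(1) _ Suc.prems(1) d] by simp
qed

lemma Ck_on_SucD: "Ck_on (Suc k) f S \<Longrightarrow> Ck_on k f S"
proof (induction k arbitrary: f)
  case 0
  then show ?case
    by (auto intro!: continuous_at_imp_continuous_on differentiable_imp_continuous_within)
qed auto

lemma Ck_on_subset: "Ck_on k f T \<Longrightarrow> S \<subseteq> T \<Longrightarrow> Ck_on k f S"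
  by (induction k arbitrary: f) (auto intro: continuous_on_subset)

lemma Ck_on_SucI:
  assumes "open S" "\<And>x. x \<in> S \<Longrightarrow> (f has_derivative f' x) (at x)"
    "\<And>v. Ck_on k (\<lambda>x. f' x v) S"
  shows "Ck_on (Suc k) f S"
proof -
  have e: "frechet_derivative f (at x) = f' x" if "x \<in> S" for x
    using frechet_derivative_at[OF assms(2)[OF that]] by simp
  have "Ck_on k (\<lambda>x. frechet_derivative f (at x) v) S" for v
    by (rule Ck_on_cong[OF assms(1) _ assms(3)[of v]]) (simp add: e)
  with assms(2) show ?thesis by (auto simp: differentiable_def)
qed

lemma Ck_on_Suc_has_derivative:
  "Ck_on (Suc k) f S \<Longrightarrow> x \<in> S \<Longrightarrow> (f has_derivative frechet_derivative f (at x)) (at x)"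
  using frechet_derivative_works by auto

lemma Ck_on_const: "open S \<Longrightarrow> Ck_on k (\<lambda>_. a) S"
proof (induction k arbitrary: a)
  case (Suc k)
  show ?case
    by (rule Ck_on_SucI[OF Suc.prems, where f' = "\<lambda>_ _. 0"]) (auto simp: Suc.IH[OF Suc.prems])
qed auto

lemma Ck_on_bounded_linear:
  assumes "bounded_linear L" "open S" "Ck_on k f S"
  shows "Ck_on k (\<lambda>x. L (f x)) S"
  using assms(3)
proof (induction k arbitrary: f)
  case 0
  then show ?case
    using bounded_linear.continuous_on[OF assms(1)] by auto
next
  case (Suc k)
  show ?case
  proof (rule Ck_on_SucI[OF assms(2)])
    fix x assume "x \<in> S"
    then show "((\<lambda>x. L (f x)) has_derivative (\<lambda>v. L (frechet_derivative f (at x) v))) (at x)"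
      by (intro bounded_linear.has_derivative[OF assms(1)] Ck_on_Suc_has_derivative[OF Suc.prems])
  qed (use Suc in simp)
qed

lemma Ck_on_add:
  assumes "open S" "Ck_on k f S" "Ck_on k g S"
  shows "Ck_on k (\<lambda>x. f x + g x) S"
  using assms(2,3)
proof (induction k arbitrary: f g)
  case 0
  then show ?case by (auto intro: continuous_intros)
next
  case (Suc k)
  show ?case
    by (rule Ck_on_SucI[OF assms(1), where f' = "\<lambda>x v. frechet_derivative f (at x) v + frechet_derivative g (at x) v"])
      (use Suc in \<open>auto intro!: has_derivative_add Ck_on_Suc_has_derivative[of k]\<close>)
qed

lemma Ck_on_bilinear:
  assumes "bounded_bilinear B" "open S" "Ck_on k f S" "Ck_on k g S"
  shows "Ck_on k (\<lambda>x. B (f x) (g x)) S"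
  using assms(3,4)
proof (induction k arbitrary: f g)
  case 0
  then show ?case using bounded_bilinear.continuous_on[OF assms(1)] by auto
next
  case (Suc k)
  show ?case
  proof (rule Ck_on_SucI[OF assms(2)])
    fix x assume "x \<in> S"
    then show "((\<lambda>x. B (f x) (g x)) has_derivative (\<lambda>v. B (f x) (frechet_derivative g (at x) v)
        + B (frechet_derivative f (at x) v) (g x))) (at x)"
      by (intro bounded_bilinear.FDERIV[OF assms(1)] Ck_on_Suc_has_derivative[OF Suc.prems(1)]
          Ck_on_Suc_has_derivative[OF Suc.prems(2)])
  next
    show "Ck_on k (\<lambda>x. B (f x) (frechet_derivative g (at x) v)
        + B (frechet_derivative f (at x) v) (g x)) S" for v
      using Suc.prems Ck_on_SucD[OF Suc.prems(1)] Ck_on_SucD[OF Suc.prems(2)]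
      by (intro Ck_on_add[OF assms(2)] Suc.IH) auto
  qed
qed

lemma Ck_on_sum:
  assumes "open S" "\<And>i. i \<in> I \<Longrightarrow> Ck_on k (f i) S"
  shows "Ck_on k (\<lambda>x. \<Sum>i\<in>I. f i x) S"
  using assms(2)
proof (induction I rule: infinite_finite_induct)
  case (insert i I)
  then show ?case by (simp add: Ck_on_add[OF assms(1)])
qed (simp_all add: Ck_on_const assms(1))

lemma Ck_on_inverse:
  fixes f :: "'a::real_normed_vector \<Rightarrow> real"
  assumes "open S" "Ck_on k f S" "\<And>x. x \<in> S \<Longrightarrow> f x \<noteq> 0"
  shows "Ck_on k (\<lambda>x. inverse (f x)) S"
  using assms(2)
proof (induction k)
  case 0
  then show ?case using assms(3) by (auto intro: continuous_intros)
next
  case (Suc k)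
  show ?case
  proof (rule Ck_on_SucI[OF assms(1)])
    fix x assume "x \<in> S"
    then show "((\<lambda>x. inverse (f x)) has_derivative
        (\<lambda>v. - (inverse (f x) * frechet_derivative f (at x) v * inverse (f x)))) (at x)"
      using assms(3) by (intro Deriv.has_derivative_inverse Ck_on_Suc_has_derivative[OF Suc.prems]) auto
  next
    fix v
    have i: "Ck_on k (\<lambda>x. inverse (f x)) S" by (rule Suc.IH[OF Ck_on_SucD[OF Suc.prems]])
    have d: "Ck_on k (\<lambda>x. frechet_derivative f (at x) v) S" using Suc.prems by simp
    show "Ck_on k (\<lambda>x. - (inverse (f x) * frechet_derivative f (at x) v * inverse (f x))) S"
      by (intro Ck_on_bounded_linear[OF bounded_linear_minus[OF bounded_linear_ident]] assms(1)
         Ck_on_bilinear[OF bounded_bilinear_mult] i d)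
  qed
qed

text \<open>By the chain rule, the derivative of \<open>f \<circ> g\<close> is a sum of products of derivatives of \<open>g\<close> with
  partial derivatives of \<open>f\<close> composed with \<open>g\<close>, to which induction on the order applies; finite
  dimension of the middle space is what makes the sum finite.\<close>
lemma Ck_on_compose:
  fixes g :: "'a::real_normed_vector \<Rightarrow> 'b::euclidean_space"
  assumes "open S" "open T" "g ` S \<subseteq> T" "Ck_on k f T" "Ck_on k g S"
  shows "Ck_on k (\<lambda>x. f (g x)) S"
  using assms(4,5)
proof (induction k arbitrary: f)
  case 0
  then show ?case using continuous_on_compose2 assms(3) by auto
next
  case (Suc k)
  let ?D = "\<lambda>x v. \<Sum>b\<in>Basis. (frechet_derivative g (at x) v \<bullet> b) *\<^sub>R frechet_derivative f (at (g x)) b"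
  show ?case
  proof (rule Ck_on_SucI[OF assms(1)])
    fix x assume x: "x \<in> S"
    have f: "(f has_derivative frechet_derivative f (at (g x))) (at (g x))"
      using x assms(3) by (intro Ck_on_Suc_has_derivative[OF Suc.prems(1)]) auto
    have "((\<lambda>x. f (g x)) has_derivative (\<lambda>v. frechet_derivative f (at (g x)) (frechet_derivative g (at x) v))) (at x)"
      using has_derivative_compose[OF Ck_on_Suc_has_derivative[OF Suc.prems(2) x] f] .
    moreover have "(\<lambda>v. frechet_derivative f (at (g x)) (frechet_derivative g (at x) v)) = ?D x"
    proof
      fix v
      define w where "w = frechet_derivative g (at x) v"
      have "frechet_derivative f (at (g x)) w = (\<Sum>b\<in>Basis. (w \<bullet> b) *\<^sub>R frechet_derivative f (at (g x)) b)"
      proof -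
        have "linear (frechet_derivative f (at (g x)))" using f has_derivative_linear by blast
        then have "frechet_derivative f (at (g x)) (\<Sum>b\<in>Basis. (w \<bullet> b) *\<^sub>R b) =
            (\<Sum>b\<in>Basis. (w \<bullet> b) *\<^sub>R frechet_derivative f (at (g x)) b)"
          by (simp add: linear_sum linear_scale)
        then show ?thesis by (simp only: euclidean_representation)
      qed
      then show "frechet_derivative f (at (g x)) (frechet_derivative g (at x) v) = ?D x v"
        by (simp only: w_def)
    qed
    ultimately show "((\<lambda>x. f (g x)) has_derivative ?D x) (at x)" by (simp only:)
  next
    fix v
    show "Ck_on k (\<lambda>x. ?D x v) S"
    proof (rule Ck_on_sum[OF assms(1)])
      fix b :: 'b
      have "Ck_on k (\<lambda>x. frechet_derivative g (at x) v \<bullet> b) S"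
        using Suc.prems(2) by (intro Ck_on_bounded_linear[OF bounded_linear_inner_left assms(1)]) simp
      moreover have "Ck_on k (\<lambda>x. frechet_derivative f (at (g x)) b) S"
        using Suc.prems(1) by (intro Suc.IH[of "\<lambda>y. frechet_derivative f (at y) b"] Ck_on_SucD[OF Suc.prems(2)]) simp
      ultimately show "Ck_on k (\<lambda>x. (frechet_derivative g (at x) v \<bullet> b) *\<^sub>R frechet_derivative f (at (g x)) b) S"
        by (rule Ck_on_bilinear[OF bounded_bilinear_scaleR assms(1)])
    qed
  qed
qed

lemma smooth_on_imp_has_derivative:
  assumes "smooth_on f S" "x \<in> S"
  shows "(f has_derivative frechet_derivative f (at x)) (at x)"
proof -
  have "Ck_on (Suc 0) f S" using assms(1) unfolding smooth_on_def ..
  from Ck_on_Suc_has_derivative[OF this assms(2)] show ?thesis .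
qed

lemma smooth_on_derivative: "smooth_on f S \<Longrightarrow> smooth_on (\<lambda>x. frechet_derivative f (at x) v) S"
  unfolding smooth_on_def using Ck_on.simps(2)[of _ f S] by auto

lemma smooth_on_cong: "open S \<Longrightarrow> (\<And>y. y \<in> S \<Longrightarrow> f y = g y) \<Longrightarrow> smooth_on f S \<Longrightarrow> smooth_on g S"
  unfolding smooth_on_def by (intro allI Ck_on_cong[of S f g]) auto

lemma smooth_on_subset: "smooth_on f T \<Longrightarrow> S \<subseteq> T \<Longrightarrow> smooth_on f S"
  unfolding smooth_on_def by (auto intro: Ck_on_subset)

lemma smooth_on_const: "open S \<Longrightarrow> smooth_on (\<lambda>_. a) S"
  by (simp add: smooth_on_def Ck_on_const)

lemma smooth_on_bounded_linear:
  "bounded_linear L \<Longrightarrow> open S \<Longrightarrow> smooth_on f S \<Longrightarrow> smooth_on (\<lambda>x. L (f x)) S"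
  unfolding smooth_on_def using Ck_on_bounded_linear[of L S _ f] by simp

lemma smooth_on_add: "open S \<Longrightarrow> smooth_on f S \<Longrightarrow> smooth_on g S \<Longrightarrow> smooth_on (\<lambda>x. f x + g x) S"
  by (simp add: smooth_on_def Ck_on_add)

lemma smooth_on_bilinear:
  "bounded_bilinear B \<Longrightarrow> open S \<Longrightarrow> smooth_on f S \<Longrightarrow> smooth_on g S \<Longrightarrow> smooth_on (\<lambda>x. B (f x) (g x)) S"
  unfolding smooth_on_def using Ck_on_bilinear[of B S _ f g] by simp

lemma smooth_on_sum:
  "open S \<Longrightarrow> (\<And>i. i \<in> I \<Longrightarrow> smooth_on (f i) S) \<Longrightarrow> smooth_on (\<lambda>x. \<Sum>i\<in>I. f i x) S"
  by (simp add: smooth_on_def Ck_on_sum)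

lemma smooth_on_inverse:
  fixes f :: "'a::real_normed_vector \<Rightarrow> real"
  shows "open S \<Longrightarrow> smooth_on f S \<Longrightarrow> (\<And>x. x \<in> S \<Longrightarrow> f x \<noteq> 0) \<Longrightarrow> smooth_on (\<lambda>x. inverse (f x)) S"
  by (simp add: smooth_on_def Ck_on_inverse)

lemma smooth_on_compose:
  fixes g :: "'a::real_normed_vector \<Rightarrow> 'b::euclidean_space"
  shows "open S \<Longrightarrow> open T \<Longrightarrow> g ` S \<subseteq> T \<Longrightarrow> smooth_on f T \<Longrightarrow> smooth_on g S \<Longrightarrow> smooth_on (\<lambda>x. f (g x)) S"
  unfolding smooth_on_def using Ck_on_compose[of S T g _ f] by simp

lemma smooth_on_ident: "open S \<Longrightarrow> smooth_on (\<lambda>x. x) S"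
proof -
  assume S: "open S"
  have "Ck_on k (\<lambda>x. x) S" for k
  proof (cases k)
    case (Suc j)
    show ?thesis unfolding Suc
      by (rule Ck_on_SucI[OF S, where f' = "\<lambda>_ v. v"]) (auto simp: Ck_on_const S)
  qed auto
  thus ?thesis by (simp add: smooth_on_def)
qed

text \<open>The symmetry of second derivatives: the second difference
  \<open>f(x+hv+hw) - f(x+hv) - f(x+hw) + f(x)\<close> is symmetric in \<open>v\<close> and \<open>w\<close>,
  and applying the mean value theorem in direction \<open>v\<close> and then in direction \<open>w\<close> turns it into
  \<open>h\<^sup>2\<close> times a mixed second derivative at a nearby point.\<close>
lemma second_difference_eq:
  fixes f :: "'a::real_normed_vector \<Rightarrow> real"
  assumes C: "Ck_on 2 f S" and h: "0 < h"
    and S: "\<And>s t. 0 \<le> s \<Longrightarrow> s \<le> h \<Longrightarrow> 0 \<le> t \<Longrightarrow> t \<le> h \<Longrightarrow> x + t *\<^sub>R v + s *\<^sub>R w \<in> S"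
  shows "\<exists>s t. 0 \<le> s \<and> s \<le> h \<and> 0 \<le> t \<and> t \<le> h \<and>
    f (x + h *\<^sub>R v + h *\<^sub>R w) - f (x + h *\<^sub>R v) - f (x + h *\<^sub>R w) + f x =
    h * h * frechet_derivative (\<lambda>z. frechet_derivative f (at z) v) (at (x + t *\<^sub>R v + s *\<^sub>R w)) w"
proof -
  define g where "g t = f (x + t *\<^sub>R v + h *\<^sub>R w) - f (x + t *\<^sub>R v)" for t
  define f' where "f' z = frechet_derivative f (at z)" for z
  define f'' where "f'' z = frechet_derivative (\<lambda>z. f' z v) (at z)" for z
  have d1: "(f has_derivative f' z) (at z)" if "z \<in> S" for z
    using C that Ck_on_Suc_has_derivative[of 1 f S z] by (simp add: numeral_2_eq_2 f'_def)
  have d2: "((\<lambda>z. f' z v) has_derivative f'' z) (at z)" if "z \<in> S" for z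
    using C that Ck_on_Suc_has_derivative[of 0 "\<lambda>z. f' z v" S z]
    by (simp add: numeral_2_eq_2 f'_def f''_def)
  have S0: "x + t *\<^sub>R v \<in> S" if "0 \<le> t" "t \<le> h" for t
    using S[of 0 t] that h by simp
  have line: "(f has_derivative f' z) (at z) \<Longrightarrow> z = y + t *\<^sub>R u \<Longrightarrow>
      ((\<lambda>t. f (y + t *\<^sub>R u)) has_real_derivative f' z u) (at t)" for z y u t and f :: "'a \<Rightarrow> real" and f'
  proof -
    assume a: "(f has_derivative f' z) (at z)" "z = y + t *\<^sub>R u"
    have "((\<lambda>t. y + t *\<^sub>R u) has_derivative (\<lambda>r. r *\<^sub>R u)) (at t)"
      by (auto intro!: derivative_eq_intros)
    from has_derivative_compose[OF this, of f "f' z"] a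
    have "((\<lambda>t. f (y + t *\<^sub>R u)) has_derivative (\<lambda>r. f' z (r *\<^sub>R u))) (at t)" by simp
    moreover have "(\<lambda>r. f' z (r *\<^sub>R u)) = (*) (f' z u)"
      using linear_scale[OF has_derivative_linear[OF a(1)]] by (auto simp: mult.commute)
    ultimately show ?thesis by (simp add: has_field_derivative_def)
  qed
  have "\<exists>t. 0 < t \<and> t < h \<and> g h - g 0 = (h - 0) * (f' (x + t *\<^sub>R v + h *\<^sub>R w) v - f' (x + t *\<^sub>R v) v)"
  proof (rule MVT2[OF h])
    fix t assume t: "0 \<le> t" "t \<le> h"
    have "((\<lambda>t. f ((x + h *\<^sub>R w) + t *\<^sub>R v)) has_real_derivative f' (x + t *\<^sub>R v + h *\<^sub>R w) v) (at t)"
      using S[of h t] t h by (intro line[of f f'] d1) (auto simp: add_ac)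
    moreover have "((\<lambda>t. f (x + t *\<^sub>R v)) has_real_derivative f' (x + t *\<^sub>R v) v) (at t)"
      using S0[of t] t by (intro line[of f f'] d1) auto
    ultimately have "((\<lambda>t. f ((x + h *\<^sub>R w) + t *\<^sub>R v) - f (x + t *\<^sub>R v)) has_real_derivative
        f' (x + t *\<^sub>R v + h *\<^sub>R w) v - f' (x + t *\<^sub>R v) v) (at t)"
      by (rule DERIV_diff)
    moreover have "(\<lambda>t. f ((x + h *\<^sub>R w) + t *\<^sub>R v) - f (x + t *\<^sub>R v)) = g"
      unfolding g_def by (simp add: add_ac)
    ultimately show "(g has_real_derivative f' (x + t *\<^sub>R v + h *\<^sub>R w) v - f' (x + t *\<^sub>R v) v) (at t)"
      by simp
  qed
  then obtain t where t: "0 < t" "t < h"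
    "g h - g 0 = h * (f' (x + t *\<^sub>R v + h *\<^sub>R w) v - f' (x + t *\<^sub>R v) v)" by auto
  have "\<exists>s. 0 < s \<and> s < h \<and> f' (x + t *\<^sub>R v + h *\<^sub>R w) v - f' (x + t *\<^sub>R v + 0 *\<^sub>R w) v = (h - 0) * f'' (x + t *\<^sub>R v + s *\<^sub>R w) w"
  proof (rule MVT2[OF h])
    fix s assume s: "0 \<le> s" "s \<le> h"
    show "((\<lambda>s. f' (x + t *\<^sub>R v + s *\<^sub>R w) v) has_real_derivative f'' (x + t *\<^sub>R v + s *\<^sub>R w) w) (at s)"
      using S[of s t] t s by (intro line[of "\<lambda>z. f' z v" f''] d2) auto
  qed
  then obtain s where s: "0 < s" "s < h"
    "f' (x + t *\<^sub>R v + h *\<^sub>R w) v - f' (x + t *\<^sub>R v) v = h * f'' (x + t *\<^sub>R v + s *\<^sub>R w) w" by auto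
  have "f (x + h *\<^sub>R v + h *\<^sub>R w) - f (x + h *\<^sub>R v) - f (x + h *\<^sub>R w) + f x = g h - g 0"
    by (simp add: g_def)
  also have "\<dots> = h * h * f'' (x + t *\<^sub>R v + s *\<^sub>R w) w" using t(3) s(3) by simp
  finally show ?thesis using t s unfolding f''_def f'_def by (intro exI[of _ s] exI[of _ t]) auto
qed

text \<open>Continuity of the second derivative lets the nearby point tend to \<open>x\<close>.\<close>
lemma second_difference_limit:
  fixes f :: "'a::real_normed_vector \<Rightarrow> real"
  assumes C: "Ck_on 2 f S" and S: "open S" "x \<in> S" and e: "0 < e"
  shows "eventually (\<lambda>h. \<bar>f (x + h *\<^sub>R v + h *\<^sub>R w) - f (x + h *\<^sub>R v) - f (x + h *\<^sub>R w) + f x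
     - h * h * frechet_derivative (\<lambda>z. frechet_derivative f (at z) v) (at x) w\<bar> < e * (h * h)) (at_right 0)"
proof -
  define f'' where "f'' z = frechet_derivative (\<lambda>z. frechet_derivative f (at z) v) (at z) w" for z
  have "continuous_on S f''" using C by (simp add: numeral_2_eq_2 f''_def)
  then obtain d where d: "d > 0" "\<And>z. z \<in> S \<Longrightarrow> dist z x < d \<Longrightarrow> dist (f'' z) (f'' x) < e"
    using S e unfolding continuous_on_iff by blast
  obtain r where r: "r > 0" "ball x r \<subseteq> S" using S open_contains_ball by blast
  \<comment> \<open>The points \<open>x + t v + s w\<close> with \<open>s, t \<le> h\<close> stay within \<open>h K\<close> of \<open>x\<close>.\<close>
  define K where "K = norm v + norm w + 1"
  have K: "K > 0" unfolding K_def by (simp add: add_nonneg_pos)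
  define m where "m = min d r / K"
  have m: "m > 0" using d r K by (simp add: m_def)
  show ?thesis
  proof (rule eventually_at_rightI[of 0 m])
    fix h assume "h \<in> {0<..<m}"
    hence h: "0 < h" "h < m" by auto
    have near: "dist (x + t *\<^sub>R v + s *\<^sub>R w) x < min d r" if "0 \<le> s" "s \<le> h" "0 \<le> t" "t \<le> h" for s t
    proof -
      have "dist (x + t *\<^sub>R v + s *\<^sub>R w) x = norm (t *\<^sub>R v + s *\<^sub>R w)" by (simp add: dist_norm)
      also have "\<dots> \<le> norm (t *\<^sub>R v) + norm (s *\<^sub>R w)" by (rule norm_triangle_ineq)
      also have "\<dots> = t * norm v + s * norm w" using that by simp
      also have "\<dots> \<le> h * norm v + h * norm w" using that by (intro add_mono mult_right_mono) auto
      also have "\<dots> \<le> h * K" using h by (simp add: K_def algebra_simps)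
      also have "\<dots> < min d r" using h K by (simp add: m_def field_simps)
      finally show ?thesis .
    qed
    have "\<exists>s t. 0 \<le> s \<and> s \<le> h \<and> 0 \<le> t \<and> t \<le> h \<and>
      f (x + h *\<^sub>R v + h *\<^sub>R w) - f (x + h *\<^sub>R v) - f (x + h *\<^sub>R w) + f x = h * h * f'' (x + t *\<^sub>R v + s *\<^sub>R w)"
      unfolding f''_def by (rule second_difference_eq[OF C h(1)])
        (use near r(2) in \<open>force simp: dist_commute\<close>)
    then obtain s t where st: "0 \<le> s" "s \<le> h" "0 \<le> t" "t \<le> h"
      "f (x + h *\<^sub>R v + h *\<^sub>R w) - f (x + h *\<^sub>R v) - f (x + h *\<^sub>R w) + f x = h * h * f'' (x + t *\<^sub>R v + s *\<^sub>R w)"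
      by blast
    have n: "dist (x + t *\<^sub>R v + s *\<^sub>R w) x < min d r" by (rule near) fact+
    hence "x + t *\<^sub>R v + s *\<^sub>R w \<in> S" using r(2) by (auto simp: dist_commute)
    hence "\<bar>f'' (x + t *\<^sub>R v + s *\<^sub>R w) - f'' x\<bar> < e" using d(2) n by (force simp: dist_real_def)
    hence "h * h * \<bar>f'' (x + t *\<^sub>R v + s *\<^sub>R w) - f'' x\<bar> < h * h * e" using h by simp
    moreover have "h * h * \<bar>f'' (x + t *\<^sub>R v + s *\<^sub>R w) - f'' x\<bar> = \<bar>h * h * f'' (x + t *\<^sub>R v + s *\<^sub>R w) - h * h * f'' x\<bar>"
      using h by (simp add: abs_mult flip: right_diff_distrib)
    ultimately show "\<bar>f (x + h *\<^sub>R v + h *\<^sub>R w) - f (x + h *\<^sub>R v) - f (x + h *\<^sub>R w) + f x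
     - h * h * frechet_derivative (\<lambda>z. frechet_derivative f (at z) v) (at x) w\<bar> < e * (h * h)"
      using st(5) by (simp add: f''_def mult.commute)
  qed (use m in auto)
qed

lemma second_derivative_symmetric_real:
  fixes f :: "'a::real_normed_vector \<Rightarrow> real"
  assumes C: "Ck_on 2 f S" and S: "open S" "x \<in> S"
  shows "frechet_derivative (\<lambda>z. frechet_derivative f (at z) v) (at x) w =
    frechet_derivative (\<lambda>z. frechet_derivative f (at z) w) (at x) v" (is "?A = ?B")
proof (rule ccontr)
  assume "?A \<noteq> ?B"
  hence e: "\<bar>?A - ?B\<bar> / 2 > 0" by simp
  have "eventually (\<lambda>h::real. False) (at_right 0)"
    using second_difference_limit[OF C S e, of v w] second_difference_limit[OF C S e, of w v]
      eventually_at_right_less[of "0::real"]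
  proof eventually_elim
    case (elim h)
    let ?D = "f (x + h *\<^sub>R v + h *\<^sub>R w) - f (x + h *\<^sub>R v) - f (x + h *\<^sub>R w) + f x"
    have "f (x + h *\<^sub>R w + h *\<^sub>R v) - f (x + h *\<^sub>R w) - f (x + h *\<^sub>R v) + f x = ?D"
      by (simp add: algebra_simps)
    with elim have "\<bar>?D - h * h * ?A\<bar> < \<bar>?A - ?B\<bar> / 2 * (h * h)" "\<bar>?D - h * h * ?B\<bar> < \<bar>?A - ?B\<bar> / 2 * (h * h)"
      by auto
    hence "\<bar>h * h * ?A - h * h * ?B\<bar> < \<bar>?A - ?B\<bar> * (h * h)" by linarith
    moreover have "\<bar>h * h * ?A - h * h * ?B\<bar> = \<bar>?A - ?B\<bar> * (h * h)"
      by (simp add: abs_mult flip: right_diff_distrib)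
    ultimately show False by simp
  qed
  thus False by simp
qed

lemma second_derivative_symmetric:
  fixes f :: "'a::real_normed_vector \<Rightarrow> 'b::euclidean_space"
  assumes C: "Ck_on 2 f S" and S: "open S" "x \<in> S"
  shows "frechet_derivative (\<lambda>z. frechet_derivative f (at z) v) (at x) w =
    frechet_derivative (\<lambda>z. frechet_derivative f (at z) w) (at x) v"
proof (rule euclidean_eqI)
  fix b :: 'b
  have 1: "(f has_derivative frechet_derivative f (at z)) (at z)" if "z \<in> S" for z
    using C that Ck_on_Suc_has_derivative[of 1 f S z] by (simp add: numeral_2_eq_2)
  have 2: "((\<lambda>z. frechet_derivative f (at z) v) has_derivative
      frechet_derivative (\<lambda>z. frechet_derivative f (at z) v) (at z)) (at z)" if "z \<in> S" for z v
    using C that Ck_on_Suc_has_derivative[of 0 "\<lambda>z. frechet_derivative f (at z) v" S z]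
    by (simp add: numeral_2_eq_2)
  have 3: "frechet_derivative (\<lambda>z. f z \<bullet> b) (at z) v = frechet_derivative f (at z) v \<bullet> b" if "z \<in> S" for z v
    using frechet_derivative_at[OF has_derivative_inner_left[OF 1[OF that], of b]] by metis
  have 4: "frechet_derivative (\<lambda>z. frechet_derivative (\<lambda>z. f z \<bullet> b) (at z) v) (at x) w =
    frechet_derivative (\<lambda>z. frechet_derivative f (at z) v) (at x) w \<bullet> b" for v w
  proof -
    have "((\<lambda>z. frechet_derivative f (at z) v \<bullet> b) has_derivative
      (\<lambda>w. frechet_derivative (\<lambda>z. frechet_derivative f (at z) v) (at x) w \<bullet> b)) (at x)"
      by (rule has_derivative_inner_left[OF 2[OF S(2)]])
    hence "((\<lambda>z. frechet_derivative (\<lambda>z. f z \<bullet> b) (at z) v) has_derivative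
      (\<lambda>w. frechet_derivative (\<lambda>z. frechet_derivative f (at z) v) (at x) w \<bullet> b)) (at x)"
      by (rule has_derivative_transform_within_open[OF _ S]) (simp add: 3)
    from frechet_derivative_at[OF this] show ?thesis by metis
  qed
  have "Ck_on 2 (\<lambda>z. f z \<bullet> b) S"
    by (rule Ck_on_bounded_linear[OF bounded_linear_inner_left S(1) C])
  from second_derivative_symmetric_real[OF this S, of v w]
  show "frechet_derivative (\<lambda>z. frechet_derivative f (at z) v) (at x) w \<bullet> b =
    frechet_derivative (\<lambda>z. frechet_derivative f (at z) w) (at x) v \<bullet> b"
    by (simp only: 4)
qed

section \<open>Calculus in a chart\<close>

text \<open>For a map into the sphere, \<open>W\<close> will be the part of the chart domain that is mapped into a given
  chart of the sphere; in general this is a proper subset of the chart domain.\<close>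
locale chart_domain =
  fixes c :: "('a, 'm::finite) chart" and W :: "'a set"
  assumes inj_coords: "inj_on (coords c) (chart_dom c)"
    and subset_dom: "W \<subseteq> chart_dom c"
    and open_image: "open (coords c ` W)"

text \<open>Meaningful for \<open>W\<close> as in the locale above, since the image of \<open>W\<close> has to be open.\<close>
definition smooth_in :: "('a, 'm::finite) chart \<Rightarrow> 'a set \<Rightarrow> ('a \<Rightarrow> 'v::real_normed_vector) \<Rightarrow> bool" where
  "smooth_in c W f \<longleftrightarrow> smooth_on (f \<circ> chart_inv c) (coords c ` W)"

lemma vec_expand: "v = (\<Sum>i\<in>UNIV. v $ i *\<^sub>R axis i 1)" for v :: "real^'n::finite"
  using basis_expansion[of v] by (simp add: scalar_mult_eq_scaleR)

lemma frechet_derivative_cong_open: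
  assumes "open S" "x \<in> S" "\<And>y. y \<in> S \<Longrightarrow> f y = g y"
  shows "frechet_derivative f (at x) = frechet_derivative g (at x)"
proof -
  have "(f has_derivative F) (at x) \<longleftrightarrow> (g has_derivative F) (at x)" for F
    using has_derivative_transform_within_open[of f F x UNIV S g]
      has_derivative_transform_within_open[of g F x UNIV S f] assms by auto
  thus ?thesis by (simp add: frechet_derivative_def)
qed

context chart_domain
begin

lemma chart_inv_coords: "p \<in> W \<Longrightarrow> chart_inv c (coords c p) = p"
  using inv_into_f_f[OF inj_coords] subset_dom by (auto simp: chart_inv_def)

lemma Dch_eqI: "((f \<circ> chart_inv c) has_derivative F) (at (coords c p)) \<Longrightarrow> Dch c f p v = F v"
  unfolding Dch_def using frechet_derivative_at by metis

lemma Dch_has_derivative: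
  "smooth_in c W f \<Longrightarrow> p \<in> W \<Longrightarrow> ((f \<circ> chart_inv c) has_derivative Dch c f p) (at (coords c p))"
  unfolding smooth_in_def Dch_def using smooth_on_imp_has_derivative by fastforce

lemma linear_Dch: "smooth_in c W f \<Longrightarrow> p \<in> W \<Longrightarrow> linear (Dch c f p)"
  using Dch_has_derivative has_derivative_linear by blast

lemma Dch_cong:
  assumes "\<And>q. q \<in> W \<Longrightarrow> f q = g q" "p \<in> W"
  shows "Dch c f p v = Dch c g p v"
proof -
  have "frechet_derivative (f \<circ> chart_inv c) (at (coords c p)) =
      frechet_derivative (g \<circ> chart_inv c) (at (coords c p))"
    using assms chart_inv_coords by (intro frechet_derivative_cong_open[OF open_image]) auto
  thus ?thesis by (simp add: Dch_def)
qed

lemma smooth_in_cong: "(\<And>q. q \<in> W \<Longrightarrow> f q = g q) \<Longrightarrow> smooth_in c W f \<Longrightarrow> smooth_in c W g"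
  unfolding smooth_in_def
  by (rule smooth_on_cong[OF open_image, of "f \<circ> chart_inv c"]) (auto simp: chart_inv_coords)

lemma Dch_bounded_linear:
  assumes "bounded_linear L" "smooth_in c W f" "p \<in> W"
  shows "Dch c (\<lambda>q. L (f q)) p v = L (Dch c f p v)"
  using bounded_linear.has_derivative[OF assms(1) Dch_has_derivative[OF assms(2,3)]]
  by (intro Dch_eqI) (simp add: o_def)

lemma smooth_in_bounded_linear:
  "bounded_linear L \<Longrightarrow> smooth_in c W f \<Longrightarrow> smooth_in c W (\<lambda>q. L (f q))"
  unfolding smooth_in_def using smooth_on_bounded_linear[OF _ open_image, of L "f \<circ> chart_inv c"]
  by (simp add: o_def)

lemma Dch_bilinear:
  assumes "bounded_bilinear B" "smooth_in c W f" "smooth_in c W g" "p \<in> W"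
  shows "Dch c (\<lambda>q. B (f q) (g q)) p v = B (f p) (Dch c g p v) + B (Dch c f p v) (g p)"
  using bounded_bilinear.FDERIV[OF assms(1) Dch_has_derivative[OF assms(2,4)] Dch_has_derivative[OF assms(3,4)]]
    chart_inv_coords[OF assms(4)]
  by (intro Dch_eqI) (simp add: o_def)

lemma smooth_in_bilinear:
  "bounded_bilinear B \<Longrightarrow> smooth_in c W f \<Longrightarrow> smooth_in c W g \<Longrightarrow> smooth_in c W (\<lambda>q. B (f q) (g q))"
  unfolding smooth_in_def
  using smooth_on_bilinear[OF _ open_image, of B "f \<circ> chart_inv c" "g \<circ> chart_inv c"]
  by (simp add: o_def)

lemma smooth_in_const: "smooth_in c W (\<lambda>_. a)"
  unfolding smooth_in_def o_def by (rule smooth_on_const[OF open_image])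

lemma Dch_const [simp]: "Dch c (\<lambda>_. a) p v = 0"
  by (rule Dch_eqI) (simp add: o_def)

lemma smooth_in_add: "smooth_in c W f \<Longrightarrow> smooth_in c W g \<Longrightarrow> smooth_in c W (\<lambda>q. f q + g q)"
  unfolding smooth_in_def
  using smooth_on_add[OF open_image, of "f \<circ> chart_inv c" "g \<circ> chart_inv c"] by (simp add: o_def)

lemma Dch_add:
  assumes "smooth_in c W f" "smooth_in c W g" "p \<in> W"
  shows "Dch c (\<lambda>q. f q + g q) p v = Dch c f p v + Dch c g p v"
  using has_derivative_add[OF Dch_has_derivative[OF assms(1,3)] Dch_has_derivative[OF assms(2,3)]]
  by (intro Dch_eqI) (simp add: o_def)

lemma smooth_in_uminus: "smooth_in c W f \<Longrightarrow> smooth_in c W (\<lambda>q. - f q)"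
  by (rule smooth_in_bounded_linear[OF bounded_linear_minus[OF bounded_linear_ident]])

lemma smooth_in_diff: "smooth_in c W f \<Longrightarrow> smooth_in c W g \<Longrightarrow> smooth_in c W (\<lambda>q. f q - g q)"
  using smooth_in_add[OF _ smooth_in_uminus, of f g] by simp

lemma smooth_in_sum: "(\<And>i. i \<in> I \<Longrightarrow> smooth_in c W (f i)) \<Longrightarrow> smooth_in c W (\<lambda>q. \<Sum>i\<in>I. f i q)"
  unfolding smooth_in_def
  using smooth_on_sum[OF open_image, of I "\<lambda>i. f i \<circ> chart_inv c"] by (simp add: o_def)

lemma Dch_sum:
  assumes "\<And>i. i \<in> I \<Longrightarrow> smooth_in c W (f i)" "p \<in> W"
  shows "Dch c (\<lambda>q. \<Sum>i\<in>I. f i q) p v = (\<Sum>i\<in>I. Dch c (f i) p v)"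
  using assms(1)
proof (induction I rule: infinite_finite_induct)
  case (insert i I)
  then show ?case
    using Dch_add[of "f i" "\<lambda>q. \<Sum>i\<in>I. f i q" p v] smooth_in_sum[of I f] assms(2) by simp
qed simp_all

lemmas smooth_in_mult = smooth_in_bilinear[OF bounded_bilinear_mult]
lemmas smooth_in_scaleR = smooth_in_bilinear[OF bounded_bilinear_scaleR]
lemmas smooth_in_inner = smooth_in_bilinear[OF bounded_bilinear_inner]
lemmas smooth_in_nth = smooth_in_bounded_linear[OF bounded_linear_vec_nth]
lemmas Dch_mult = Dch_bilinear[OF bounded_bilinear_mult]
lemmas Dch_scaleR = Dch_bilinear[OF bounded_bilinear_scaleR]
lemmas Dch_inner = Dch_bilinear[OF bounded_bilinear_inner]
lemmas Dch_nth = Dch_bounded_linear[OF bounded_linear_vec_nth]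

lemma smooth_in_Dch: "smooth_in c W f \<Longrightarrow> smooth_in c W (\<lambda>q. Dch c f q v)"
proof -
  assume f: "smooth_in c W f"
  have "smooth_on (\<lambda>y. frechet_derivative (f \<circ> chart_inv c) (at y) v) (coords c ` W)"
    using f smooth_on_derivative unfolding smooth_in_def by blast
  thus ?thesis
    unfolding smooth_in_def
    by (rule smooth_on_cong[OF open_image, rotated]) (auto simp: Dch_def chart_inv_coords)
qed

lemma smooth_in_inverse:
  fixes f :: "'a \<Rightarrow> real"
  shows "smooth_in c W f \<Longrightarrow> (\<And>q. q \<in> W \<Longrightarrow> f q \<noteq> 0) \<Longrightarrow> smooth_in c W (\<lambda>q. inverse (f q))"
  unfolding smooth_in_def
  using smooth_on_inverse[OF open_image, of "f \<circ> chart_inv c"] by (force simp: o_def chart_inv_coords)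

lemma smooth_in_prod:
  fixes f :: "'i \<Rightarrow> 'a \<Rightarrow> real"
  shows "(\<And>i. i \<in> I \<Longrightarrow> smooth_in c W (f i)) \<Longrightarrow> smooth_in c W (\<lambda>q. \<Prod>i\<in>I. f i q)"
  by (induction I rule: infinite_finite_induct) (auto intro: smooth_in_const smooth_in_mult)

lemma smooth_in_vec:
  fixes f :: "'a \<Rightarrow> real^'n"
  assumes "\<And>i. smooth_in c W (\<lambda>q. f q $ i)"
  shows "smooth_in c W f"
proof -
  have "smooth_in c W (\<lambda>q. \<Sum>i\<in>UNIV. f q $ i *\<^sub>R axis i 1)"
    by (intro smooth_in_sum smooth_in_scaleR assms smooth_in_const)
  thus ?thesis by (rule smooth_in_cong[rotated]) (rule vec_expand[symmetric])
qed

lemma Dch_symmetric: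
  fixes f :: "'a \<Rightarrow> 'v::euclidean_space"
  assumes "smooth_in c W f" "p \<in> W"
  shows "Dch c (\<lambda>q. Dch c f q v) p w = Dch c (\<lambda>q. Dch c f q w) p v"
proof -
  have e: "Dch c (\<lambda>q. Dch c f q v) p w = frechet_derivative
      (\<lambda>y. frechet_derivative (f \<circ> chart_inv c) (at y) v) (at (coords c p)) w" for v w
  proof -
    have "frechet_derivative ((\<lambda>q. Dch c f q v) \<circ> chart_inv c) (at (coords c p)) =
      frechet_derivative (\<lambda>y. frechet_derivative (f \<circ> chart_inv c) (at y) v) (at (coords c p))"
      using assms(2) by (intro frechet_derivative_cong_open[OF open_image]) (auto simp: Dch_def chart_inv_coords)
    thus ?thesis by (simp add: Dch_def[of c "\<lambda>q. Dch c f q v"])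
  qed
  show ?thesis unfolding e
    using assms second_derivative_symmetric[OF _ open_image, of "f \<circ> chart_inv c" "coords c p" v w]
    by (auto simp: smooth_in_def smooth_on_def)
qed

lemma Dch_expand: "smooth_in c W f \<Longrightarrow> p \<in> W \<Longrightarrow> Dch c f p v = (\<Sum>i\<in>UNIV. v $ i *\<^sub>R \<partial> c i f p)"
proof -
  assume "smooth_in c W f" "p \<in> W"
  hence l: "linear (Dch c f p)" by (rule linear_Dch)
  have "Dch c f p v = Dch c f p (\<Sum>i\<in>UNIV. v $ i *\<^sub>R axis i 1)"
    by (simp only: vec_expand[symmetric])
  thus ?thesis by (simp add: linear_sum[OF l] linear_scale[OF l])
qed

lemma smooth_in_compose:
  assumes d: "chart_domain d V" and \<phi>: "\<phi> ` W \<subseteq> V" "smooth_in c W (\<lambda>q. coords d (\<phi> q))"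
    and f: "smooth_in d V f"
  shows "smooth_in c W (\<lambda>q. f (\<phi> q))"
proof -
  interpret d: chart_domain d V by fact
  let ?u = "(\<lambda>q. coords d (\<phi> q)) \<circ> chart_inv c"
  have "?u ` coords c ` W \<subseteq> coords d ` V" using \<phi>(1) by (auto simp: chart_inv_coords)
  from smooth_on_compose[OF open_image d.open_image this f[unfolded smooth_in_def] \<phi>(2)[unfolded smooth_in_def]]
  have "smooth_on (\<lambda>y. (f \<circ> chart_inv d) (?u y)) (coords c ` W)" .
  thus ?thesis unfolding smooth_in_def
    by (rule smooth_on_cong[OF open_image, rotated])
      (use \<phi>(1) in \<open>auto simp: chart_inv_coords d.chart_inv_coords image_subset_iff\<close>)
qed

lemma Dch_compose:
  assumes d: "chart_domain d V" and \<phi>: "\<phi> ` W \<subseteq> V" "smooth_in c W (\<lambda>q. coords d (\<phi> q))"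
    and f: "smooth_in d V f" and p: "p \<in> W"
  shows "Dch c (\<lambda>q. f (\<phi> q)) p v = Dch d f (\<phi> p) (Dch c (\<lambda>q. coords d (\<phi> q)) p v)"
proof (rule Dch_eqI)
  interpret d: chart_domain d V by fact
  let ?u = "(\<lambda>q. coords d (\<phi> q)) \<circ> chart_inv c"
  have p': "\<phi> p \<in> V" using \<phi>(1) p by auto
  have "((f \<circ> chart_inv d) has_derivative Dch d f (\<phi> p)) (at (?u (coords c p)))"
    using d.Dch_has_derivative[OF f p'] by (simp add: chart_inv_coords p)
  from has_derivative_compose[OF Dch_has_derivative[OF \<phi>(2) p] this]
  have "((\<lambda>y. (f \<circ> chart_inv d) (?u y)) has_derivative
      (\<lambda>v. Dch d f (\<phi> p) (Dch c (\<lambda>q. coords d (\<phi> q)) p v))) (at (coords c p))" .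
  then show "(((\<lambda>q. f (\<phi> q)) \<circ> chart_inv c) has_derivative
      (\<lambda>v. Dch d f (\<phi> p) (Dch c (\<lambda>q. coords d (\<phi> q)) p v))) (at (coords c p))"
    by (rule has_derivative_transform_within_open[OF _ open_image])
      (use p \<phi>(1) in \<open>auto simp: chart_inv_coords d.chart_inv_coords image_subset_iff\<close>)
qed

lemma smooth_in_coords: "smooth_in c W (coords c)"
  unfolding smooth_in_def
  by (rule smooth_on_cong[OF open_image _ smooth_on_ident[OF open_image]]) (auto simp: chart_inv_coords)

lemma Dch_coords: "p \<in> W \<Longrightarrow> Dch c (coords c) p v = v"
proof (rule Dch_eqI)
  assume p: "p \<in> W"
  show "((coords c \<circ> chart_inv c) has_derivative (\<lambda>v. v)) (at (coords c p))"
    by (rule has_derivative_transform_within_open[OF has_derivative_ident open_image])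
      (use p in \<open>auto simp: chart_inv_coords\<close>)
qed

end


section \<open>The metric in a chart\<close>

locale riem_chart = chart_domain c W for c :: "('a, 'm::finite) chart" and W :: "'a set" +
  fixes M :: "('a, 'm) riem_mfd"
  assumes smooth_metric: "\<And>i j. smooth_in c W (\<lambda>q. rmetric M c q $ i $ j)"
    and sym_metric: "p \<in> W \<Longrightarrow> transpose (rmetric M c p) = rmetric M c p"
    and pos_metric: "p \<in> W \<Longrightarrow> v \<noteq> 0 \<Longrightarrow> v \<bullet> (rmetric M c p *v v) > 0"
begin

abbreviation g where "g p i j \<equiv> rmetric M c p $ i $ j"
abbreviation h where "h p i j \<equiv> inv_metric M c p $ i $ j"
abbreviation \<Gamma> where "\<Gamma> \<equiv> christoffel M c"

lemma g_commute: "p \<in> W \<Longrightarrow> g p i j = g p j i"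
  using arg_cong[OF sym_metric[of p], of "\<lambda>A. A $ i $ j"] by (simp add: transpose_def)

lemma invertible_metric: "p \<in> W \<Longrightarrow> invertible (rmetric M c p)"
proof -
  assume p: "p \<in> W"
  have "x = 0" if "rmetric M c p *v x = 0" for x
    using pos_metric[OF p, of x] that by (cases "x = 0") auto
  hence "\<exists>B. B ** rmetric M c p = mat 1"
    using matrix_left_invertible_ker[of "rmetric M c p"] by blast
  thus ?thesis using invertible_left_inverse by blast
qed

lemma metric_inv:
  assumes "p \<in> W"
  shows "rmetric M c p ** inv_metric M c p = mat 1" "inv_metric M c p ** rmetric M c p = mat 1"
  using someI_ex[OF invertible_metric[OF assms, unfolded invertible_def]]
  by (simp_all add: inv_metric_def matrix_inv_def)

lemma g_h: "p \<in> W \<Longrightarrow> (\<Sum>k\<in>UNIV. g p i k * h p k j) = (if i = j then 1 else 0)"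
  using metric_inv(1)[of p] unfolding matrix_matrix_mult_def mat_def vec_eq_iff by simp

lemma h_g: "p \<in> W \<Longrightarrow> (\<Sum>k\<in>UNIV. h p i k * g p k j) = (if i = j then 1 else 0)"
  using metric_inv(2)[of p] unfolding matrix_matrix_mult_def mat_def vec_eq_iff by simp

lemma h_commute: "p \<in> W \<Longrightarrow> h p i j = h p j i"
proof -
  assume p: "p \<in> W"
  have "transpose (inv_metric M c p) ** rmetric M c p = mat 1"
    using metric_inv(1)[OF p] sym_metric[OF p] by (metis matrix_transpose_mul transpose_mat)
  hence "transpose (inv_metric M c p) = inv_metric M c p"
    using metric_inv(1)[OF p] by (metis matrix_mul_assoc matrix_mul_lid matrix_mul_rid)
  from arg_cong[OF this, of "\<lambda>A. A $ i $ j"] show ?thesis by (simp add: transpose_def)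
qed

text \<open>Identities for raised indices are proved by lowering the index, where the Christoffel symbols are
  plain derivatives of the metric.\<close>
lemma lower_cancel:
  assumes p: "p \<in> W" and e: "\<And>l. (\<Sum>k\<in>UNIV. g p l k * x k) = (\<Sum>k\<in>UNIV. g p l k * y k)"
  shows "x k = y k"
proof -
  have "(\<Sum>l\<in>UNIV. h p k l * (\<Sum>j\<in>UNIV. g p l j * z j)) = z k" for z
  proof -
    have "(\<Sum>l\<in>UNIV. h p k l * (\<Sum>j\<in>UNIV. g p l j * z j)) = (\<Sum>j\<in>UNIV. (\<Sum>l\<in>UNIV. h p k l * g p l j) * z j)"
      unfolding sum_distrib_left sum_distrib_right by (subst sum.swap) (simp add: mult.assoc)
    also have "\<dots> = z k" using p by (simp add: h_g if_distrib[of "\<lambda>x. x * _"] cong: if_cong)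
    finally show ?thesis .
  qed
  from this[of x] this[of y] e show ?thesis by simp
qed

text \<open>The inverse metric enters every trace, so its smoothness is needed throughout. Cramer's rule exhibits the entries of the inverse matrix as quotients of polynomials in the
  entries of the metric.\<close>
lemma smooth_inv_metric: "smooth_in c W (\<lambda>q. h q i j)"
proof -
  define A where "A q = (\<chi> r s. if s = i then axis j 1 $ r else g q r s)" for q
  have det: "smooth_in c W (\<lambda>q. det (B q))"
    if "\<And>r s. smooth_in c W (\<lambda>q. B q $ r $ s)" for B :: "'a \<Rightarrow> real^'m^'m"
    unfolding det_def by (intro smooth_in_sum smooth_in_mult smooth_in_const smooth_in_prod that)
  have nz: "det (rmetric M c q) \<noteq> 0" if "q \<in> W" for q
    using invertible_metric[OF that] invertible_det_nz by blast
  have "smooth_in c W (\<lambda>q. A q $ r $ s)" for r s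
    by (cases "s = i") (simp_all add: A_def smooth_in_const smooth_metric)
  hence "smooth_in c W (\<lambda>q. det (A q) * inverse (det (rmetric M c q)))"
    by (intro smooth_in_mult smooth_in_inverse det smooth_metric nz)
  moreover have "det (A q) * inverse (det (rmetric M c q)) = h q i j" if "q \<in> W" for q
  proof -
    have "rmetric M c q *v (inv_metric M c q *v axis j 1) = axis j 1"
      using metric_inv(1)[OF that] by (simp add: matrix_vector_mul_assoc)
    from this[unfolded cramer[OF nz[OF that]]]
    have "(inv_metric M c q *v axis j 1) $ i = det (A q) / det (rmetric M c q)"
      by (simp add: A_def)
    moreover have "(inv_metric M c q *v axis j 1) $ i = h q i j"
      by (simp add: matrix_vector_mult_basis column_def)
    ultimately show ?thesis by (simp add: divide_inverse)
  qed
  ultimately show ?thesis by (rule smooth_in_cong[rotated])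
qed

lemma smooth_christoffel: "smooth_in c W (\<lambda>q. \<Gamma> q k i j)"
proof -
  have "smooth_in c W (\<lambda>q. \<Gamma> q k i j * 2)"
    unfolding christoffel_def
    by (simp, intro smooth_in_sum smooth_in_mult smooth_inv_metric smooth_in_add smooth_in_diff smooth_in_Dch
       smooth_metric smooth_inv_metric)
  from smooth_in_mult[OF this smooth_in_const[of "1/2"]] show ?thesis by simp
qed

lemma christoffel_lower:
  assumes "p \<in> W"
  shows "(\<Sum>k\<in>UNIV. g p l k * \<Gamma> p k i j) =
    (\<partial> c i (\<lambda>q. g q j l) p + \<partial> c j (\<lambda>q. g q i l) p - \<partial> c l (\<lambda>q. g q i j) p) / 2"
proof -
  define z where "z l = (\<partial> c i (\<lambda>q. g q j l) p + \<partial> c j (\<lambda>q. g q i l) p - \<partial> c l (\<lambda>q. g q i j) p) / 2" for l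
  have "\<Gamma> p k i j = (\<Sum>m\<in>UNIV. h p k m * z m)" for k
    by (simp add: christoffel_def z_def sum_divide_distrib)
  hence "(\<Sum>k\<in>UNIV. g p l k * \<Gamma> p k i j) = (\<Sum>m\<in>UNIV. (\<Sum>k\<in>UNIV. g p l k * h p k m) * z m)"
    unfolding sum_distrib_left sum_distrib_right by simp (subst sum.swap, simp add: mult.assoc sum_distrib_left)
  also have "\<dots> = z l" using assms by (simp add: g_h if_distrib[of "\<lambda>x. x * _"] cong: if_cong)
  finally show ?thesis by (simp add: z_def)
qed

text \<open>In the sum of the two lowered Christoffel symbols the derivatives in the directions \<open>k\<close> and \<open>l\<close>
  cancel.\<close>
lemma metric_compatible:
  assumes "p \<in> W"
  shows "\<partial> c i (\<lambda>q. g q l k) p = (\<Sum>m\<in>UNIV. g p l m * \<Gamma> p m i k) + (\<Sum>m\<in>UNIV. g p k m * \<Gamma> p m i l)"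
proof -
  have sw: "\<partial> c r (\<lambda>q. g q a b) p = \<partial> c r (\<lambda>q. g q b a) p" for r a b
    by (rule Dch_cong[OF _ assms]) (rule g_commute)
  show ?thesis
    unfolding christoffel_lower[OF assms] sw[where r = i and a = l and b = k] by (simp add: field_simps)
qed

text \<open>The inverse metric is parallel: differentiate \<open>g h = 1\<close> and insert the compatibility of the
  connection with \<open>g\<close>.\<close>
lemma inv_metric_parallel:
  assumes p: "p \<in> W"
  shows "\<partial> c i (\<lambda>q. h q k j) p = - (\<Sum>b\<in>UNIV. \<Gamma> p k i b * h p b j) - (\<Sum>a\<in>UNIV. h p k a * \<Gamma> p j i a)"
proof (rule lower_cancel[OF p, where x = "\<lambda>k. \<partial> c i (\<lambda>q. h q k j) p" and k = k
      and y = "\<lambda>k. - (\<Sum>b\<in>UNIV. \<Gamma> p k i b * h p b j) - (\<Sum>a\<in>UNIV. h p k a * \<Gamma> p j i a)"])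
  fix l
  have "0 = Dch c (\<lambda>q. \<Sum>k\<in>UNIV. g q l k * h q k j) p (axis i 1)"
    by (subst Dch_cong[OF g_h p]) simp_all
  also have "\<dots> = (\<Sum>k\<in>UNIV. g p l k * \<partial> c i (\<lambda>q. h q k j) p + \<partial> c i (\<lambda>q. g q l k) p * h p k j)"
    by (subst Dch_sum) (auto intro!: smooth_in_mult smooth_metric smooth_inv_metric p
        simp: Dch_mult[OF smooth_metric smooth_inv_metric p])
  finally have 1: "(\<Sum>k\<in>UNIV. g p l k * \<partial> c i (\<lambda>q. h q k j) p) = - (\<Sum>k\<in>UNIV. \<partial> c i (\<lambda>q. g q l k) p * h p k j)"
    by (simp add: sum.distrib)
  have 2: "(\<Sum>k\<in>UNIV. (\<Sum>m\<in>UNIV. g p k m * \<Gamma> p m i l) * h p k j) = \<Gamma> p j i l"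
  proof -
    have "(\<Sum>k\<in>UNIV. (\<Sum>m\<in>UNIV. g p k m * \<Gamma> p m i l) * h p k j) = (\<Sum>m\<in>UNIV. (\<Sum>k\<in>UNIV. g p m k * h p k j) * \<Gamma> p m i l)"
      unfolding sum_distrib_left sum_distrib_right
      by (subst sum.swap) (simp add: mult_ac g_commute[OF p])
    also have "\<dots> = \<Gamma> p j i l" using p by (simp add: g_h if_distrib[of "\<lambda>x. x * _"] cong: if_cong)
    finally show ?thesis .
  qed
  have 3: "(\<Sum>k\<in>UNIV. g p l k * (\<Sum>a\<in>UNIV. h p k a * \<Gamma> p j i a)) = \<Gamma> p j i l"
  proof -
    have "(\<Sum>k\<in>UNIV. g p l k * (\<Sum>a\<in>UNIV. h p k a * \<Gamma> p j i a)) = (\<Sum>a\<in>UNIV. (\<Sum>k\<in>UNIV. g p l k * h p k a) * \<Gamma> p j i a)"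
      unfolding sum_distrib_left sum_distrib_right by (subst sum.swap) (simp add: mult_ac)
    also have "\<dots> = \<Gamma> p j i l" using p by (simp add: g_h if_distrib[of "\<lambda>x. x * _"] cong: if_cong)
    finally show ?thesis .
  qed
  have 4: "(\<Sum>k\<in>UNIV. g p l k * (\<Sum>b\<in>UNIV. \<Gamma> p k i b * h p b j)) = (\<Sum>b\<in>UNIV. (\<Sum>m\<in>UNIV. g p l m * \<Gamma> p m i b) * h p b j)"
    unfolding sum_distrib_left sum_distrib_right by (subst sum.swap) (simp add: mult_ac)
  show "(\<Sum>k\<in>UNIV. g p l k * \<partial> c i (\<lambda>q. h q k j) p) = (\<Sum>k\<in>UNIV. g p l k *
      (- (\<Sum>b\<in>UNIV. \<Gamma> p k i b * h p b j) - (\<Sum>a\<in>UNIV. h p k a * \<Gamma> p j i a)))"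
    unfolding 1 metric_compatible[OF p]
    by (simp add: right_diff_distrib distrib_right sum.distrib sum_subtractf sum_negf 2 3 4)
qed

text \<open>Raising the index commutes with covariant differentiation because the inverse metric is
  parallel; so the divergence of \<open>\<theta>\<^sup>\<sharp>\<close> is the trace of \<open>\<nabla>\<theta>\<close>.\<close>
lemma divergence_sharp:
  assumes p: "p \<in> W" and s: "\<And>j. smooth_in c W (\<lambda>q. \<theta> q (axis j 1))"
  shows "divergence M c (sharp M c \<theta>) p =
    trace_g M c p (\<lambda>i j. \<partial> c i (\<lambda>q. \<theta> q (axis j 1)) p - (\<Sum>k\<in>UNIV. \<Gamma> p k i j * \<theta> p (axis k 1)))"
proof -
  define t where "t j = (\<lambda>q. \<theta> q (axis j 1))" for j
  have st: "smooth_in c W (t j)" for j unfolding t_def by (rule s)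
  have X: "sharp M c \<theta> q $ i = (\<Sum>j\<in>UNIV. h q i j * t j q)" for q i
    by (simp add: sharp_def matrix_vector_mult_def t_def)
  have sX: "smooth_in c W (sharp M c \<theta>)"
    by (rule smooth_in_vec) (simp add: X smooth_in_sum smooth_in_mult smooth_inv_metric st)
  have D: "Dch c (sharp M c \<theta>) p v $ i = (\<Sum>j\<in>UNIV. h p i j * Dch c (t j) p v + Dch c (\<lambda>q. h q i j) p v * t j p)" for i v
    unfolding Dch_nth[OF sX p, symmetric] X
    by (subst Dch_sum) (auto intro!: smooth_in_mult smooth_inv_metric p st
        simp: Dch_mult[OF smooth_inv_metric st p])
  have if_sum: "(\<Sum>j\<in>UNIV. if P then f j else 0) = (if P then sum f UNIV else 0)" for P and f :: "'m \<Rightarrow> real"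
    by simp
  have "divergence M c (sharp M c \<theta>) p = (\<Sum>i\<in>UNIV. (\<Sum>j\<in>UNIV. h p i j * \<partial> c i (t j) p)
      + (\<Sum>j\<in>UNIV. \<partial> c i (\<lambda>q. h q i j) p * t j p) + (\<Sum>k\<in>UNIV. \<Gamma> p i i k * (\<Sum>j\<in>UNIV. h p k j * t j p)))"
    unfolding divergence_def levi_civita_def christoffel_form_def
    by (simp add: D X sum.distrib axis_def if_distrib[of "\<lambda>x. _ * x"] if_distrib[of "\<lambda>x. x * _"] if_sum cong: if_cong)
  also have "\<dots> = (\<Sum>i\<in>UNIV. \<Sum>j\<in>UNIV. h p i j * \<partial> c i (t j) p) - (\<Sum>i\<in>UNIV. \<Sum>j\<in>UNIV. (\<Sum>a\<in>UNIV. h p i a * \<Gamma> p j i a) * t j p)"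
  proof -
    have "(\<Sum>k\<in>UNIV. \<Gamma> p i i k * (\<Sum>j\<in>UNIV. h p k j * t j p)) = (\<Sum>j\<in>UNIV. (\<Sum>b\<in>UNIV. \<Gamma> p i i b * h p b j) * t j p)" for i
      unfolding sum_distrib_left sum_distrib_right by (subst sum.swap) (simp add: mult_ac)
    thus ?thesis
      by (simp add: inv_metric_parallel[OF p] sum.distrib sum_subtractf left_diff_distrib sum_negf)
  qed
  also have "(\<Sum>i\<in>UNIV. \<Sum>j\<in>UNIV. (\<Sum>a\<in>UNIV. h p i a * \<Gamma> p j i a) * t j p) = (\<Sum>i\<in>UNIV. \<Sum>j\<in>UNIV. h p i j * (\<Sum>k\<in>UNIV. \<Gamma> p k i j * t k p))"
    unfolding sum_distrib_left sum_distrib_right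
    by (rule sum.cong[OF refl]) (subst sum.swap, simp add: mult_ac)
  finally show ?thesis
    by (simp add: trace_g_def t_def right_diff_distrib sum_subtractf)
qed

end

section \<open>The unit sphere in its charts\<close>

lemma is_chart_inj_on: "is_chart X c \<Longrightarrow> inj_on (coords c) (chart_dom c)"
proof -
  assume c: "is_chart X c"
  hence "topspace (subtopology X (chart_dom c)) = chart_dom c"
    by (auto simp: is_chart_def dest: openin_subset)
  thus ?thesis using c homeomorphic_imp_injective_map unfolding is_chart_def by fastforce
qed

lemma is_chart_open_image:
  assumes c: "is_chart X c" and U: "openin X U"
  shows "open (coords c ` (chart_dom c \<inter> U))"
proof -
  have "openin (subtopology X (chart_dom c)) (chart_dom c \<inter> U)"
    using U by (metis inf_commute openin_subtopology_Int)
  hence "openin (top_of_set (coords c ` chart_dom c)) (coords c ` (chart_dom c \<inter> U))"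
    using c homeomorphic_imp_open_map unfolding is_chart_def open_map_def by blast
  thus ?thesis using c openin_open_trans unfolding is_chart_def by blast
qed

lemma chart_domain_restrict:
  "is_chart X c \<Longrightarrow> openin X U \<Longrightarrow> W = chart_dom c \<inter> U \<Longrightarrow> chart_domain c W"
  by unfold_locales (auto simp: is_chart_inj_on is_chart_open_image)

lemma matrix_vector_mult_inner: "v \<bullet> (A *v w) = (\<Sum>i\<in>UNIV. \<Sum>j\<in>UNIV. v $ i * A $ i $ j * w $ j)"
  for v :: "real^'n::finite"
  by (simp add: inner_vec_def matrix_vector_mult_def sum_distrib_left mult.assoc)

text \<open>By dimension count, \<open>n\<close> and the image of \<open>L\<close> span the whole space. For a chart of the sphere, with
  \<open>n\<close> the position vector, a vector identity may therefore be checked separately against tangent vectors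
  and against the position vector.\<close>
lemma orthogonal_complement_trivial:
  fixes L :: "real^'n::finite \<Rightarrow> real^'k::finite"
  assumes dim: "CARD('k) = CARD('n) + 1" and L: "linear L" "inj L"
    and n: "n \<noteq> 0" "\<And>v. n \<bullet> L v = 0"
    and z: "n \<bullet> z = 0" "\<And>v. L v \<bullet> z = 0"
  shows "z = 0"
proof -
  have "dim (range L) = CARD('n)"
    using dim_image_eq[OF L(1), of UNIV] L(2) by (simp add: inj_on_def)
  moreover have "n \<notin> span (range L)"
  proof
    assume "n \<in> span (range L)"
    moreover have "span (range L) = range L"
      using linear_subspace_image[OF L(1) subspace_UNIV] span_eq_iff by blast
    ultimately obtain v where "n = L v" by auto
    with n(1) n(2)[of v] show False by simp
  qed
  ultimately have "dim (insert n (range L)) = CARD('k)" by (simp add: dim_insert dim)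
  hence "span (insert n (range L)) = UNIV"
    using dim_eq_full[of "insert n (range L)"] by simp
  hence "z \<in> span (insert n (range L))" by simp
  moreover have "orthogonal z x" if "x \<in> insert n (range L)" for x
    using that z by (auto simp: orthogonal_def inner_commute)
  ultimately have "orthogonal z z" using orthogonal_to_span by blast
  thus ?thesis by (simp add: orthogonal_self)
qed

locale sphere_chart =
  fixes d :: "(real^'k::finite, 'n::finite) chart"
  assumes dim: "CARD('k) = CARD('n) + 1"
    and d: "d \<in> atlas (sphere_mfd :: (real^'k, 'n) riem_mfd)"
begin

abbreviation S :: "(real^'k, 'n) riem_mfd" where "S \<equiv> sphere_mfd"
abbreviation V where "V \<equiv> chart_dom d"

text \<open>The differential of the inclusion of the sphere: it turns components in the chart into vectors
  of the ambient space.\<close>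
abbreviation E :: "real^'k \<Rightarrow> real^'n \<Rightarrow> real^'k" where "E \<equiv> Dch d (\<lambda>q. q)"

lemma is_chart: "is_chart (top_of_set (sphere 0 1)) d"
  using d by (simp add: sphere_mfd_def)

lemma V_sphere: "q \<in> V \<Longrightarrow> q \<bullet> q = 1"
proof -
  assume "q \<in> V"
  moreover have "V \<subseteq> sphere 0 1"
    using is_chart openin_subset unfolding is_chart_def by fastforce
  ultimately show ?thesis by (auto simp: norm_eq_1)
qed

sublocale chart_domain d "chart_dom d"
  using is_chart by (unfold_locales) (auto simp: is_chart_inj_on is_chart_def)

lemma smooth_inclusion: "smooth_in d V (\<lambda>q. q)"
  using d by (simp add: sphere_mfd_def smooth_in_def o_def)

lemmas smooth_E = smooth_in_Dch[OF smooth_inclusion]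

lemma rmetric_S: "rmetric S d q $ a $ b = E q (axis a 1) \<bullet> E q (axis b 1)"
  by (simp add: sphere_mfd_def)

lemma linear_E: "q \<in> V \<Longrightarrow> linear (E q)"
  by (rule linear_Dch[OF smooth_inclusion])

lemma E_expand: "q \<in> V \<Longrightarrow> E q v = (\<Sum>a\<in>UNIV. v $ a *\<^sub>R E q (axis a 1))"
  by (rule Dch_expand[OF smooth_inclusion])

lemma inj_E: "q \<in> V \<Longrightarrow> inj (E q)"
  using d unfolding Dch_def by (auto simp: sphere_mfd_def o_def)

lemma metric_S: "q \<in> V \<Longrightarrow> v \<bullet> (rmetric S d q *v w) = E q v \<bullet> E q w"
  unfolding matrix_vector_mult_inner rmetric_S E_expand[of q v] E_expand[of q w]
  by (simp add: inner_sum_left inner_sum_right mult_ac sum_distrib_left) (rule sum.swap)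

sublocale riem_chart d "chart_dom d" sphere_mfd
proof
  show "smooth_in d V (\<lambda>q. rmetric S d q $ i $ j)" for i j
    unfolding rmetric_S by (intro smooth_in_inner smooth_E)
  show "transpose (rmetric S d p) = rmetric S d p" for p
    by (simp add: vec_eq_iff transpose_def rmetric_S inner_commute)
  show "v \<bullet> (rmetric S d p *v v) > 0" if "p \<in> V" "v \<noteq> 0" for p v
    using that metric_S[of p v v] inj_E[of p] linear_injective_0[OF linear_E, of p] by auto
qed

lemma normal_E: "q \<in> V \<Longrightarrow> q \<bullet> E q v = 0"
proof -
  assume q: "q \<in> V"
  have "0 = Dch d (\<lambda>q. q \<bullet> q) q v" by (subst Dch_cong[OF V_sphere q]) simp_all
  also have "\<dots> = 2 * (q \<bullet> E q v)"
    by (subst Dch_inner[OF smooth_inclusion smooth_inclusion q]) (simp add: inner_commute)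
  finally show ?thesis by simp
qed

lemma normal_D_E: "q \<in> V \<Longrightarrow> q \<bullet> Dch d (\<lambda>q. E q v) q w = - (E q v \<bullet> E q w)"
proof -
  assume q: "q \<in> V"
  have "0 = Dch d (\<lambda>q. q \<bullet> E q v) q w" by (subst Dch_cong[OF normal_E q]) simp_all
  also have "\<dots> = q \<bullet> Dch d (\<lambda>q. E q v) q w + E q w \<bullet> E q v"
    by (rule Dch_inner[OF smooth_inclusion smooth_E q])
  finally show ?thesis by (simp add: inner_commute)
qed

text \<open>The Gauss formula: the second derivative of the inclusion minus the Christoffel part is
  \<open>-\<langle>E v, E w\<rangle> q\<close>. Against tangent vectors this is the Koszul formula for the induced metric,
  against the position vector it is the derivative of \<open>\<langle>q, E v\<rangle> = 0\<close> (\<open>normal_D_E\<close>).\<close>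
lemma gauss_formula_axis:
  assumes q: "q \<in> V"
  shows "Dch d (\<lambda>q. E q (axis j 1)) q (axis i 1) =
    (\<Sum>k\<in>UNIV. \<Gamma> q k i j *\<^sub>R E q (axis k 1)) - (E q (axis i 1) \<bullet> E q (axis j 1)) *\<^sub>R q"
proof -
  define D where "D i j = Dch d (\<lambda>q. E q (axis j 1)) q (axis i 1)" for i j
  define Z where "Z = D i j - (\<Sum>k\<in>UNIV. \<Gamma> q k i j *\<^sub>R E q (axis k 1)) + (E q (axis i 1) \<bullet> E q (axis j 1)) *\<^sub>R q"
  have sym: "D i j = D j i" for i j unfolding D_def by (rule Dch_symmetric[OF smooth_inclusion q])
  have dg: "\<partial> d i (\<lambda>q. g q j l) q = E q (axis j 1) \<bullet> D i l + D i j \<bullet> E q (axis l 1)" for i j l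
    unfolding rmetric_S D_def by (rule Dch_inner[OF smooth_E smooth_E q])
  have "E q (axis l 1) \<bullet> Z = 0" for l
  proof -
    have "E q (axis l 1) \<bullet> (\<Sum>k\<in>UNIV. \<Gamma> q k i j *\<^sub>R E q (axis k 1)) = (\<Sum>k\<in>UNIV. g q l k * \<Gamma> q k i j)"
      by (simp add: inner_sum_right rmetric_S mult.commute)
    also have "\<dots> = E q (axis l 1) \<bullet> D i j"
      unfolding christoffel_lower[OF q] dg
      by (simp add: sym[of i j] sym[of l i] sym[of l j] inner_commute)
    finally show ?thesis
      using normal_E[OF q, of "axis l 1"] by (simp add: Z_def inner_diff_right inner_add_right inner_commute)
  qed
  hence "E q v \<bullet> Z = 0" for v
    unfolding E_expand[OF q, of v] by (simp add: inner_sum_left)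
  moreover have "q \<bullet> Z = 0"
    unfolding Z_def D_def using normal_E[OF q] V_sphere[OF q] normal_D_E[OF q, of "axis j 1" "axis i 1"]
    by (simp add: inner_diff_right inner_add_right inner_sum_right inner_commute)
  ultimately have "Z = 0"
    using V_sphere[OF q]
    by (intro orthogonal_complement_trivial[OF dim linear_E[OF q] inj_E[OF q], of q]) (auto simp: normal_E[OF q])
  thus ?thesis by (simp add: Z_def D_def algebra_simps)
qed

lemma smooth_E_compose:
  assumes c: "chart_domain c W" and \<phi>: "\<phi> ` W \<subseteq> V" "smooth_in c W (\<lambda>q. coords d (\<phi> q))"
    and \<sigma>: "smooth_in c W \<sigma>"
  shows "smooth_in c W (\<lambda>q. E (\<phi> q) (\<sigma> q))"
proof -
  interpret c: chart_domain c W by fact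
  have "smooth_in c W (\<lambda>q. \<Sum>a\<in>UNIV. \<sigma> q $ a *\<^sub>R E (\<phi> q) (axis a 1))"
    by (intro c.smooth_in_sum c.smooth_in_scaleR c.smooth_in_nth \<sigma>
        c.smooth_in_compose[OF chart_domain_axioms \<phi> smooth_E])
  then show ?thesis
    by (rule c.smooth_in_cong[rotated], subst (2) E_expand) (use \<phi>(1) in auto)
qed

text \<open>Expand \<open>\<sigma>\<close> in the coordinate frame: the product rule and the Gauss formula produce the Christoffel
  part and a multiple of the position vector. The right-hand side is the derivative in the ambient space
  projected to the tangent space, since \<open>\<langle>\<phi>, E \<sigma>\<rangle> = 0\<close> implies that the normal component of the
  derivative of \<open>E \<sigma>\<close> is \<open>- \<langle>D\<phi>, E \<sigma>\<rangle>\<close>.\<close>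
lemma E_pullback_connection:
  assumes c: "chart_domain c W" and \<phi>: "\<phi> ` W \<subseteq> V" "smooth_in c W (\<lambda>q. coords d (\<phi> q))"
    and \<sigma>: "smooth_in c W \<sigma>" and p: "p \<in> W"
  shows "E (\<phi> p) (Dch c \<sigma> p v + christoffel_form S d (\<phi> p) (Dch c (\<lambda>q. coords d (\<phi> q)) p v) (\<sigma> p)) =
    Dch c (\<lambda>q. E (\<phi> q) (\<sigma> q)) p v + (Dch c \<phi> p v \<bullet> E (\<phi> p) (\<sigma> p)) *\<^sub>R \<phi> p"
proof -
  interpret c: chart_domain c W by fact
  define u where "u = Dch c (\<lambda>q. coords d (\<phi> q)) p v"
  have q: "\<phi> p \<in> V" using \<phi>(1) p by auto
  have sE: "smooth_in c W (\<lambda>q. E (\<phi> q) w)" for w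
    by (rule c.smooth_in_compose[OF chart_domain_axioms \<phi> smooth_E])
  have D\<phi>: "Dch c \<phi> p v = E (\<phi> p) u"
    unfolding u_def by (rule c.Dch_compose[OF chart_domain_axioms \<phi> smooth_inclusion p])
  have DE: "Dch c (\<lambda>q. E (\<phi> q) w) p v = Dch d (\<lambda>q. E q w) (\<phi> p) u" for w
    unfolding u_def by (rule c.Dch_compose[OF chart_domain_axioms \<phi> smooth_E p])
  have "Dch c (\<lambda>q. E (\<phi> q) (\<sigma> q)) p v = Dch c (\<lambda>q. \<Sum>a\<in>UNIV. \<sigma> q $ a *\<^sub>R E (\<phi> q) (axis a 1)) p v"
    using \<phi>(1) by (intro c.Dch_cong[OF _ p] E_expand) auto
  also have "\<dots> = (\<Sum>a\<in>UNIV. \<sigma> p $ a *\<^sub>R Dch c (\<lambda>q. E (\<phi> q) (axis a 1)) p v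
      + Dch c \<sigma> p v $ a *\<^sub>R E (\<phi> p) (axis a 1))"
    by (subst c.Dch_sum)
      (auto intro!: c.smooth_in_scaleR c.smooth_in_nth \<sigma> sE p
        simp: c.Dch_scaleR[OF c.smooth_in_nth[OF \<sigma>] sE p] c.Dch_nth[OF \<sigma> p])
  also have "\<dots> = E (\<phi> p) (Dch c \<sigma> p v) + (\<Sum>a\<in>UNIV. \<sigma> p $ a *\<^sub>R Dch d (\<lambda>q. E q (axis a 1)) (\<phi> p) u)"
    unfolding sum.distrib E_expand[OF q, of "Dch c \<sigma> p v"] DE by simp
  also have "(\<Sum>a\<in>UNIV. \<sigma> p $ a *\<^sub>R Dch d (\<lambda>q. E q (axis a 1)) (\<phi> p) u) =
     (\<Sum>a\<in>UNIV. \<Sum>i\<in>UNIV. (\<sigma> p $ a * u $ i) *\<^sub>R ((\<Sum>k\<in>UNIV. \<Gamma> (\<phi> p) k i a *\<^sub>R E (\<phi> p) (axis k 1))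
       - (E (\<phi> p) (axis i 1) \<bullet> E (\<phi> p) (axis a 1)) *\<^sub>R \<phi> p))"
    by (simp add: Dch_expand[OF smooth_E q, of _ u] gauss_formula_axis[OF q] scaleR_sum_right)
  also have "\<dots> = (\<Sum>a\<in>UNIV. \<Sum>i\<in>UNIV. \<Sum>k\<in>UNIV. (\<sigma> p $ a * u $ i * \<Gamma> (\<phi> p) k i a) *\<^sub>R E (\<phi> p) (axis k 1))
     - (\<Sum>a\<in>UNIV. \<Sum>i\<in>UNIV. (\<sigma> p $ a * u $ i * (E (\<phi> p) (axis i 1) \<bullet> E (\<phi> p) (axis a 1))) *\<^sub>R \<phi> p)"
    by (simp add: scaleR_diff_right sum_subtractf scaleR_sum_right)
  also have "(\<Sum>a\<in>UNIV. \<Sum>i\<in>UNIV. \<Sum>k\<in>UNIV. (\<sigma> p $ a * u $ i * \<Gamma> (\<phi> p) k i a) *\<^sub>R E (\<phi> p) (axis k 1)) =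
     E (\<phi> p) (christoffel_form S d (\<phi> p) u (\<sigma> p))"
  proof -
    have "E (\<phi> p) (christoffel_form S d (\<phi> p) u (\<sigma> p)) =
      (\<Sum>k\<in>UNIV. \<Sum>i\<in>UNIV. \<Sum>a\<in>UNIV. (\<sigma> p $ a * u $ i * \<Gamma> (\<phi> p) k i a) *\<^sub>R E (\<phi> p) (axis k 1))"
      unfolding E_expand[OF q, of "christoffel_form S d (\<phi> p) u (\<sigma> p)"]
      by (simp add: christoffel_form_def scaleR_sum_left mult_ac)
    also have "\<dots> = (\<Sum>i\<in>UNIV. \<Sum>k\<in>UNIV. \<Sum>a\<in>UNIV. (\<sigma> p $ a * u $ i * \<Gamma> (\<phi> p) k i a) *\<^sub>R E (\<phi> p) (axis k 1))"
      by (rule sum.swap)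
    also have "\<dots> = (\<Sum>i\<in>UNIV. \<Sum>a\<in>UNIV. \<Sum>k\<in>UNIV. (\<sigma> p $ a * u $ i * \<Gamma> (\<phi> p) k i a) *\<^sub>R E (\<phi> p) (axis k 1))"
      by (intro sum.cong refl sum.swap)
    also have "\<dots> = (\<Sum>a\<in>UNIV. \<Sum>i\<in>UNIV. \<Sum>k\<in>UNIV. (\<sigma> p $ a * u $ i * \<Gamma> (\<phi> p) k i a) *\<^sub>R E (\<phi> p) (axis k 1))"
      by (rule sum.swap)
    finally show ?thesis by simp
  qed
  also have "(\<Sum>a\<in>UNIV. \<Sum>i\<in>UNIV. (\<sigma> p $ a * u $ i * (E (\<phi> p) (axis i 1) \<bullet> E (\<phi> p) (axis a 1))) *\<^sub>R \<phi> p) =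
     (E (\<phi> p) u \<bullet> E (\<phi> p) (\<sigma> p)) *\<^sub>R \<phi> p"
    unfolding E_expand[OF q, of u] E_expand[OF q, of "\<sigma> p"]
    by (simp add: inner_sum_left inner_sum_right scaleR_sum_left sum_distrib_left mult_ac)
  finally show ?thesis
    by (simp add: linear_add[OF linear_E[OF q]] D\<phi> u_def)
qed

text \<open>The Levi-Civita connection is the pullback connection along the identity.\<close>
lemma E_levi_civita:
  assumes Y: "smooth_in d V Y" and q: "q \<in> V"
  shows "E q (levi_civita S d (\<lambda>_. u) Y q) = Dch d (\<lambda>q. E q (Y q)) q u + (E q u \<bullet> E q (Y q)) *\<^sub>R q"
  using E_pullback_connection[OF chart_domain_axioms, of "\<lambda>q. q" Y q u] Y q
  by (simp add: levi_civita_def Dch_coords smooth_in_coords)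

lemma smooth_levi_civita_const: "smooth_in d V (levi_civita S d (\<lambda>_. v) (\<lambda>_. w))"
  by (rule smooth_in_vec)
    (simp add: levi_civita_def christoffel_form_def smooth_in_sum smooth_in_mult smooth_in_const smooth_christoffel)

text \<open>The Gauss equation. In the ambient space the third derivatives of the inclusion cancel by
  symmetry, and the normal part of the difference vanishes because the left-hand side is tangent.\<close>
lemma E_curvature:
  assumes q: "q \<in> V"
  shows "E q (curvature S d q u v w) = (E q v \<bullet> E q w) *\<^sub>R E q u - (E q u \<bullet> E q w) *\<^sub>R E q v"
proof -
  define Y where "Y v = levi_civita S d (\<lambda>_. v) (\<lambda>_. w)" for v
  have sY: "smooth_in d V (Y v)" for v unfolding Y_def by (rule smooth_levi_civita_const)
  have EY: "E q (Y v q) = Dch d (\<lambda>q. E q w) q v + (E q v \<bullet> E q w) *\<^sub>R q" if "q \<in> V" for q v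
    unfolding Y_def by (rule E_levi_civita[OF smooth_in_const that])
  have 1: "E q (levi_civita S d (\<lambda>_. u) (Y v) q) = Dch d (\<lambda>q. Dch d (\<lambda>q. E q w) q v) q u
      + (E q v \<bullet> E q w) *\<^sub>R E q u + (Dch d (\<lambda>q. E q v \<bullet> E q w) q u + E q u \<bullet> E q (Y v q)) *\<^sub>R q" for u v
  proof -
    have "E q (levi_civita S d (\<lambda>_. u) (Y v) q) =
        Dch d (\<lambda>q. Dch d (\<lambda>q. E q w) q v + (E q v \<bullet> E q w) *\<^sub>R q) q u + (E q u \<bullet> E q (Y v q)) *\<^sub>R q"
      unfolding E_levi_civita[OF sY q] by (subst Dch_cong[OF EY q]) simp_all
    also have "Dch d (\<lambda>q. Dch d (\<lambda>q. E q w) q v + (E q v \<bullet> E q w) *\<^sub>R q) q u =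
        Dch d (\<lambda>q. Dch d (\<lambda>q. E q w) q v) q u + ((E q v \<bullet> E q w) *\<^sub>R E q u + Dch d (\<lambda>q. E q v \<bullet> E q w) q u *\<^sub>R q)"
      by (subst Dch_add[OF smooth_in_Dch[OF smooth_E] smooth_in_scaleR[OF smooth_in_inner[OF smooth_E smooth_E] smooth_inclusion] q],
          subst Dch_scaleR[OF smooth_in_inner[OF smooth_E smooth_E] smooth_inclusion q]) simp
    finally show ?thesis by (simp add: scaleR_add_left)
  qed
  have 2: "curvature S d q u v w = levi_civita S d (\<lambda>_. u) (Y v) q - levi_civita S d (\<lambda>_. v) (Y u) q"
    unfolding curvature_def curvature_op_def Y_def
    by (simp add: lie_bracket_def levi_civita_def[of _ _ "lie_bracket d _ _"] christoffel_form_def vec_eq_iff)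
  have 3: "Dch d (\<lambda>q. Dch d (\<lambda>q. E q w) q v) q u = Dch d (\<lambda>q. Dch d (\<lambda>q. E q w) q u) q v"
    by (rule Dch_symmetric[OF smooth_E q])
  \<comment> \<open>The coefficient of the position vector in the formula above; tangency makes its antisymmetric part vanish.\<close>
  define N where "N u v = Dch d (\<lambda>q. E q v \<bullet> E q w) q u + E q u \<bullet> E q (Y v q)" for u v
  define r where "r = N u v - N v u"
  have r: "E q (curvature S d q u v w) = (E q v \<bullet> E q w) *\<^sub>R E q u - (E q u \<bullet> E q w) *\<^sub>R E q v + r *\<^sub>R q"
    unfolding 2 linear_diff[OF linear_E[OF q]] 1 3 r_def N_def[symmetric] by (simp add: scaleR_diff_left)
  have "r = q \<bullet> E q (curvature S d q u v w)"
    unfolding r using normal_E[OF q] V_sphere[OF q] by (simp add: inner_add_right inner_diff_right)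
  hence "r = 0" using normal_E[OF q] by simp
  with r show ?thesis by simp
qed

end

subsection \<open>Existence of charts\<close>

text \<open>Stereographic projection from the antipode of \<open>x\<close>. Its inverse is rational, hence smooth, and is
  an immersion because the projection extends to a differentiable left inverse near each point.\<close>
lemma sphere_chart_exists:
  fixes x :: "real^'k::finite"
  assumes dim: "CARD('k) = CARD('n::finite) + 1" and x: "x \<in> sphere 0 1"
  shows "\<exists>d\<in>atlas (sphere_mfd :: (real^'k, 'n) riem_mfd). x \<in> chart_dom d"
proof -
  define a where "a = - x"
  have aa: "a \<bullet> a = 1" using x by (simp add: a_def norm_eq_1)
  hence "a \<noteq> 0" by auto
  hence "dim {y. a \<bullet> y = 0} = dim (UNIV :: (real^'n) set)"
    using dim_hyperplane[of a] dim by simp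
  then obtain L :: "real^'n \<Rightarrow> real^'k" and P where
    L: "linear L" "linear P" "L ` UNIV = {y. a \<bullet> y = 0}"
      "\<And>y. norm (L y) = norm y" "\<And>y. P (L y) = y"
      "\<And>w. a \<bullet> w = 0 \<Longrightarrow> norm (P w) = norm w" "\<And>w. a \<bullet> w = 0 \<Longrightarrow> L (P w) = w"
    using isometries_subspaces[OF subspace_UNIV subspace_hyperplane[of a]] by (smt (verit) UNIV_I mem_Collect_eq)
  \<comment> \<open>\<open>L\<close> identifies the chart space isometrically with the hyperplane orthogonal to the pole \<open>a\<close>, and
    \<open>P\<close> inverts it there; \<open>\<kappa>\<close> below projects from \<open>a\<close> to that hyperplane, with inverse \<open>F\<close>.\<close>
  have aL: "a \<bullet> L y = 0" for y using L(3) by blast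
  have LL: "L y \<bullet> L y = y \<bullet> y" for y using L(4)[of y] by (simp add: norm_eq_sqrt_inner)
  define \<kappa> where "\<kappa> z = inverse (1 - z \<bullet> a) *\<^sub>R P (z - (z \<bullet> a) *\<^sub>R a)" for z
  define F where "F y = inverse (1 + y \<bullet> y) *\<^sub>R (2 *\<^sub>R L y + (y \<bullet> y - 1) *\<^sub>R a)" for y
  have nz: "1 + y \<bullet> y \<noteq> 0" "1 + y \<bullet> y > 0" for y :: "real^'n" by (smt (verit) inner_ge_zero)+
  have Fa: "F y \<bullet> a = (y \<bullet> y - 1) / (1 + y \<bullet> y)" for y
    using aL[of y] aa by (simp add: F_def inner_add_left inner_commute[of "L y" a] divide_inverse mult.commute)
  have Fa1: "1 - F y \<bullet> a = 2 / (1 + y \<bullet> y)" for y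
    unfolding Fa using nz[of y] by (simp add: field_simps)
  have FF: "F y \<bullet> F y = 1" for y
  proof -
    have "(2 *\<^sub>R L y + (y \<bullet> y - 1) *\<^sub>R a) \<bullet> (2 *\<^sub>R L y + (y \<bullet> y - 1) *\<^sub>R a) = (1 + y \<bullet> y) * (1 + y \<bullet> y)"
      using aL[of y] aa LL[of y] by (simp add: inner_add_left inner_add_right inner_commute algebra_simps)
    hence "F y \<bullet> F y = (inverse (1 + y \<bullet> y) * (1 + y \<bullet> y)) * (inverse (1 + y \<bullet> y) * (1 + y \<bullet> y))"
      by (simp only: F_def inner_scaleR_left inner_scaleR_right mult_ac)
    thus ?thesis using left_inverse[OF nz(1)[of y]] by simp
  qed
  have \<kappa>F: "\<kappa> (F y) = y" for y
  proof -
    have "F y - (F y \<bullet> a) *\<^sub>R a = (2 / (1 + y \<bullet> y)) *\<^sub>R L y"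
      unfolding Fa by (simp add: F_def scaleR_add_right divide_inverse mult.commute)
    hence "P (F y - (F y \<bullet> a) *\<^sub>R a) = (2 / (1 + y \<bullet> y)) *\<^sub>R y"
      by (simp add: linear_scale[OF L(2)] L(5))
    moreover have "inverse (2 / (1 + y \<bullet> y)) * (2 / (1 + y \<bullet> y)) = 1"
      using nz(2)[of y] by (intro left_inverse) simp
    ultimately show ?thesis unfolding \<kappa>_def Fa1 by (simp only: scaleR_scaleR scaleR_one)
  qed
  define D where "D = sphere 0 1 - {a}"
  have FD: "F y \<in> D" for y
  proof -
    have "F y \<noteq> a" using Fa1[of y] aa nz[of y] by auto
    thus ?thesis using FF[of y] by (simp add: D_def norm_eq_1)
  qed
  have za: "1 - z \<bullet> a \<noteq> 0" if "z \<in> D" for z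
  proof
    assume "1 - z \<bullet> a = 0"
    hence "(z - a) \<bullet> (z - a) = 0"
      using that aa by (simp add: D_def norm_eq_1 inner_diff_left inner_diff_right inner_commute)
    thus False using that by (simp add: D_def)
  qed
  have F\<kappa>: "F (\<kappa> z) = z" if z: "z \<in> D" for z
  proof -
    define s where "s = z \<bullet> a"
    define w where "w = z - s *\<^sub>R a"
    have zz: "z \<bullet> z = 1" using z by (simp add: D_def norm_eq_1)
    have s: "1 - s \<noteq> 0" using za[OF z] by (simp add: s_def)
    have aw: "a \<bullet> w = 0" using aa by (simp add: w_def s_def inner_diff_right inner_commute)
    have "w \<bullet> w = 1 - s * s"
      using aa zz by (simp add: w_def s_def inner_diff_left inner_diff_right inner_commute)
    hence PP: "P w \<bullet> P w = (1 - s) * (1 + s)"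
      using L(6)[OF aw] by (simp add: norm_eq_sqrt_inner algebra_simps)
    have y: "\<kappa> z = inverse (1 - s) *\<^sub>R P w" by (simp add: \<kappa>_def s_def w_def)
    have yy: "\<kappa> z \<bullet> \<kappa> z = (1 + s) / (1 - s)"
    proof -
      have "inverse (1 - s) * ((1 - s) * r) = r" for r using s by simp
      thus ?thesis
        unfolding y by (simp only: inner_scaleR_left inner_scaleR_right PP divide_inverse) (rule mult.commute)
    qed
    have 1: "inverse (1 + \<kappa> z \<bullet> \<kappa> z) = (1 - s) / 2" unfolding yy using s by (simp add: field_simps)
    have 2: "\<kappa> z \<bullet> \<kappa> z - 1 = 2 * s / (1 - s)" unfolding yy using s by (simp add: field_simps)
    have 3: "L (\<kappa> z) = inverse (1 - s) *\<^sub>R w" by (simp add: y linear_scale[OF L(1)] L(7)[OF aw])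
    have "F (\<kappa> z) = ((1 - s) / 2 * (2 * inverse (1 - s))) *\<^sub>R w + ((1 - s) / 2 * (2 * s / (1 - s))) *\<^sub>R a"
      unfolding F_def 1 2 3 by (simp add: scaleR_add_right)
    also have "\<dots> = w + s *\<^sub>R a" using s by simp
    finally show ?thesis by (simp add: w_def)
  qed
  define d where "d = (D, \<kappa>)"
  have img: "\<kappa> ` D = UNIV" using FD \<kappa>F by (metis UNIV_eq_I image_eqI)
  have inv: "chart_inv d = F"
  proof
    fix y
    have "inj_on \<kappa> D" using F\<kappa> by (metis inj_on_inverseI)
    from inv_into_f_eq[OF this FD \<kappa>F] show "chart_inv d y = F y" by (simp add: chart_inv_def d_def)
  qed
  have bl: "bounded_linear L" "bounded_linear P" using L(1,2) linear_conv_bounded_linear by auto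
  have sF: "smooth_on F UNIV"
    unfolding F_def
    by (intro smooth_on_bilinear[OF bounded_bilinear_scaleR open_UNIV] smooth_on_inverse[OF open_UNIV]
        smooth_on_add[OF open_UNIV] smooth_on_const[OF open_UNIV] smooth_on_ident[OF open_UNIV]
        smooth_on_bilinear[OF bounded_bilinear_inner open_UNIV] smooth_on_bounded_linear[OF bl(1) open_UNIV]
        smooth_on_add[OF open_UNIV, of "\<lambda>y. y \<bullet> y" "\<lambda>_. -1", simplified])
      (use nz in auto)
  have "continuous_on D \<kappa>"
    unfolding \<kappa>_def using za
    by (intro continuous_intros bounded_linear.continuous_on[OF bl(2)]) auto
  moreover have "continuous_on UNIV F"
    using sF unfolding smooth_on_def using Ck_on.simps(1) by blast
  ultimately have "homeomorphic_maps (top_of_set D) (top_of_set UNIV) \<kappa> F"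
    using FD \<kappa>F F\<kappa> by (auto simp: homeomorphic_maps_def continuous_map_in_subtopology)
  hence "homeomorphic_map (subtopology (top_of_set (sphere 0 1)) D) (top_of_set UNIV) \<kappa>"
    using homeomorphic_map_maps by (force simp: subtopology_subtopology D_def Int_absorb1)
  moreover have "openin (top_of_set (sphere 0 1)) D" unfolding D_def by (intro openin_delete) simp
  ultimately have "is_chart (top_of_set (sphere 0 1)) d" by (simp add: is_chart_def d_def img)
  moreover have "inj (frechet_derivative F (at y))" for y
  proof -
    have F': "(F has_derivative frechet_derivative F (at y)) (at y)"
      by (rule smooth_on_imp_has_derivative[OF sF]) simp
    have "\<kappa> differentiable at (F y)"
    proof -
      have "((\<lambda>z. P (z - (z \<bullet> a) *\<^sub>R a)) has_derivative (\<lambda>v. P (v - (v \<bullet> a) *\<^sub>R a))) (at (F y))"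
        by (intro bounded_linear.has_derivative[OF bl(2)]) (auto intro!: derivative_eq_intros)
      moreover have "(\<lambda>z. 1 - z \<bullet> a) differentiable (at (F y))"
        by (rule differentiableI, rule has_derivative_diff[OF has_derivative_const has_derivative_inner_left[OF has_derivative_ident]])
      ultimately show ?thesis
        unfolding \<kappa>_def using za[OF FD[of y]]
        by (intro differentiable_scaleR differentiable_inverse) (auto intro: differentiableI)
    qed
    then obtain \<kappa>' where \<kappa>': "(\<kappa> has_derivative \<kappa>') (at (F y))" unfolding differentiable_def by blast
    from has_derivative_compose[OF F' \<kappa>'] have "((\<lambda>y. y) has_derivative (\<lambda>v. \<kappa>' (frechet_derivative F (at y) v))) (at y)"
      by (simp add: \<kappa>F)
    from has_derivative_unique[OF this has_derivative_ident]
    have "\<kappa>' (frechet_derivative F (at y) v) = v" for v by metis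
    thus ?thesis by (metis injI)
  qed
  ultimately have "d \<in> atlas (sphere_mfd :: (real^'k, 'n) riem_mfd)"
    using sF by (simp add: sphere_mfd_def inv) (simp add: d_def img)
  moreover have "x \<in> chart_dom d"
  proof -
    have "x \<bullet> a = - 1" using aa by (simp add: a_def)
    hence "x \<noteq> a" using aa by auto
    thus ?thesis using x by (simp add: d_def D_def)
  qed
  ultimately show ?thesis by blast
qed

section \<open>Traces and the Laplacian\<close>

lemma trace_g_add: "trace_g M c p (\<lambda>i j. A i j + B i j) = trace_g M c p A + trace_g M c p B"
  by (simp add: trace_g_def scaleR_add_right sum.distrib)

lemma trace_g_diff: "trace_g M c p (\<lambda>i j. A i j - B i j) = trace_g M c p A - trace_g M c p B"
  by (simp add: trace_g_def scaleR_diff_right sum_subtractf)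

lemma trace_g_linear: "linear L \<Longrightarrow> L (trace_g M c p B) = trace_g M c p (\<lambda>i j. L (B i j))"
  by (simp add: trace_g_def linear_sum linear_scale)

lemma trace_g_scaleR_left: "trace_g M c p (\<lambda>i j. r i j *\<^sub>R x) = trace_g M c p r *\<^sub>R x"
  by (simp add: trace_g_def scaleR_sum_left)

lemma trace_g_uminus: "trace_g M c p (\<lambda>i j. - B i j) = - trace_g M c p B"
  by (simp add: trace_g_def sum_negf)

context riem_chart
begin

lemma trace_g_swap: "p \<in> W \<Longrightarrow> trace_g M c p (\<lambda>i j. B j i) = trace_g M c p B"
  unfolding trace_g_def by (subst sum.swap) (simp add: h_commute)

lemma smooth_trace: "(\<And>i j. smooth_in c W (B i j)) \<Longrightarrow> smooth_in c W (\<lambda>q. trace_g M c q (\<lambda>i j. B i j q))"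
  unfolding trace_g_def by (intro smooth_in_sum smooth_in_scaleR smooth_inv_metric)

text \<open>The trace of the Hessian, that is the opposite of the Laplacian; this sign avoids a minus in every
  step, and the definition covers vector-valued functions as well.\<close>
definition lap :: "('a \<Rightarrow> 'v::real_normed_vector) \<Rightarrow> 'a \<Rightarrow> 'v" where
  "lap f p = trace_g M c p (\<lambda>i j. \<partial> c i (\<lambda>q. \<partial> c j f q) p - (\<Sum>k\<in>UNIV. \<Gamma> p k i j *\<^sub>R \<partial> c k f p))"

lemma conn_laplacian_eq_lap: "conn_laplacian M c (\<partial> c) f p = - lap f p"
  by (simp add: conn_laplacian_def lap_def)

lemma smooth_lap: "smooth_in c W f \<Longrightarrow> smooth_in c W (lap f)"
  unfolding lap_def
  by (intro smooth_trace smooth_in_diff smooth_in_sum smooth_in_scaleR smooth_in_Dch smooth_christoffel)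

lemma lap_cong:
  assumes "\<And>q. q \<in> W \<Longrightarrow> f q = u q" "p \<in> W"
  shows "lap f p = lap u p"
proof -
  have 1: "\<partial> c j f q = \<partial> c j u q" if "q \<in> W" for j q by (rule Dch_cong[OF assms(1) that])
  have 2: "\<partial> c i (\<lambda>q. \<partial> c j f q) p = \<partial> c i (\<lambda>q. \<partial> c j u q) p" for i j by (rule Dch_cong[OF 1 assms(2)])
  show ?thesis unfolding lap_def 2 1[OF assms(2)] ..
qed

lemma lap_add:
  assumes f: "smooth_in c W f" and u: "smooth_in c W u" and p: "p \<in> W"
  shows "lap (\<lambda>q. f q + u q) p = lap f p + lap u p"
proof -
  have 1: "\<partial> c j (\<lambda>q. f q + u q) q = \<partial> c j f q + \<partial> c j u q" if "q \<in> W" for j q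
    by (rule Dch_add[OF f u that])
  have 2: "\<partial> c i (\<lambda>q. \<partial> c j (\<lambda>q. f q + u q) q) p = \<partial> c i (\<lambda>q. \<partial> c j f q) p + \<partial> c i (\<lambda>q. \<partial> c j u q) p" for i j
    by (rule trans[OF Dch_cong[OF 1 p] Dch_add[OF smooth_in_Dch[OF f] smooth_in_Dch[OF u] p]])
  show ?thesis unfolding lap_def 2 1[OF p] trace_g_add[symmetric]
    by (simp add: scaleR_add_right sum.distrib algebra_simps)
qed

lemma lap_scaleR:
  assumes r: "smooth_in c W r" and f: "smooth_in c W f" and p: "p \<in> W"
  shows "lap (\<lambda>q. r q *\<^sub>R f q) p = r p *\<^sub>R lap f p + lap r p *\<^sub>R f p
    + 2 *\<^sub>R trace_g M c p (\<lambda>i j. \<partial> c j r p *\<^sub>R \<partial> c i f p)"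
proof -
  let ?H = "\<lambda>i j. \<partial> c i (\<lambda>q. \<partial> c j f q) p - (\<Sum>k\<in>UNIV. \<Gamma> p k i j *\<^sub>R \<partial> c k f p)"
  let ?K = "\<lambda>i j. \<partial> c i (\<lambda>q. \<partial> c j r q) p - (\<Sum>k\<in>UNIV. \<Gamma> p k i j *\<^sub>R \<partial> c k r p)"
  have 1: "\<partial> c j (\<lambda>q. r q *\<^sub>R f q) q = r q *\<^sub>R \<partial> c j f q + \<partial> c j r q *\<^sub>R f q" if "q \<in> W" for j q
    by (rule Dch_scaleR[OF r f that])
  have 2: "\<partial> c i (\<lambda>q. \<partial> c j (\<lambda>q. r q *\<^sub>R f q) q) p = r p *\<^sub>R \<partial> c i (\<lambda>q. \<partial> c j f q) p
      + \<partial> c i r p *\<^sub>R \<partial> c j f p + \<partial> c j r p *\<^sub>R \<partial> c i f p + \<partial> c i (\<lambda>q. \<partial> c j r q) p *\<^sub>R f p" for i j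
  proof -
    have "\<partial> c i (\<lambda>q. \<partial> c j (\<lambda>q. r q *\<^sub>R f q) q) p = \<partial> c i (\<lambda>q. r q *\<^sub>R \<partial> c j f q + \<partial> c j r q *\<^sub>R f q) p"
      by (rule Dch_cong[OF 1 p])
    also have "\<dots> = \<partial> c i (\<lambda>q. r q *\<^sub>R \<partial> c j f q) p + \<partial> c i (\<lambda>q. \<partial> c j r q *\<^sub>R f q) p"
      by (intro Dch_add smooth_in_scaleR smooth_in_Dch r f p)
    also have "\<dots> = (r p *\<^sub>R \<partial> c i (\<lambda>q. \<partial> c j f q) p + \<partial> c i r p *\<^sub>R \<partial> c j f p)
        + (\<partial> c j r p *\<^sub>R \<partial> c i f p + \<partial> c i (\<lambda>q. \<partial> c j r q) p *\<^sub>R f p)"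
      by (simp only: Dch_scaleR[OF r smooth_in_Dch[OF f] p] Dch_scaleR[OF smooth_in_Dch[OF r] f p])
    finally show ?thesis by (simp only: add.assoc)
  qed
  have "lap (\<lambda>q. r q *\<^sub>R f q) p = trace_g M c p (\<lambda>i j. r p *\<^sub>R ?H i j + ?K i j *\<^sub>R f p
      + (\<partial> c i r p *\<^sub>R \<partial> c j f p + \<partial> c j r p *\<^sub>R \<partial> c i f p))"
    unfolding lap_def 2 1[OF p]
    by (rule arg_cong[of _ _ "trace_g M c p"], intro ext)
      (simp add: scaleR_add_right sum.distrib scaleR_diff_right scaleR_diff_left scaleR_sum_right scaleR_sum_left mult.commute)
  also have "\<dots> = r p *\<^sub>R lap f p + lap r p *\<^sub>R f p + 2 *\<^sub>R trace_g M c p (\<lambda>i j. \<partial> c j r p *\<^sub>R \<partial> c i f p)"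
    using trace_g_swap[OF p, of "\<lambda>i j. \<partial> c j r p *\<^sub>R \<partial> c i f p"]
      trace_g_linear[OF linear_scale_self, of "r p" M c p ?H]
    unfolding trace_g_add trace_g_scaleR_left lap_def by (simp add: scaleR_2 )
  finally show ?thesis .
qed

lemma differential_grad:
  assumes f: "smooth_in c W f" and p: "p \<in> W"
  shows "Dch c f p (grad M c r p) = trace_g M c p (\<lambda>i j. \<partial> c j r p *\<^sub>R \<partial> c i f p)"
  unfolding Dch_expand[OF f p, of "grad M c r p"] trace_g_def
  by (simp add: grad_def sharp_def matrix_vector_mult_def scaleR_sum_left)

lemma levi_civita_const:
  "levi_civita M c (\<lambda>_. axis i 1) (\<lambda>_. axis j 1) p = (\<chi> k. \<Gamma> p k i j)"
  by (simp add: levi_civita_def christoffel_form_def vec_eq_iff axis_def if_distrib[of "\<lambda>x. _ * x"] cong: if_cong)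

end


section \<open>Maps into Euclidean space\<close>

lemma std_chart_simps: "chart_dom std_chart = UNIV" "coords std_chart = (\<lambda>x. x)" "chart_inv std_chart = (\<lambda>x. x)"
  by (auto simp: std_chart_def chart_inv_def fun_eq_iff inv_into_f_eq)

lemma christoffel_form_euclidean: "christoffel_form euclidean_mfd std_chart p u v = 0"
  by (simp add: christoffel_form_def christoffel_def euclidean_mfd_def Dch_def o_def vec_eq_iff)

lemma differential_euclidean: "differential c std_chart f = Dch c f"
  by (simp add: differential_def std_chart_simps o_def)

lemma pullback_conn_euclidean: "pullback_conn euclidean_mfd c std_chart f = \<partial> c"
  by (simp add: fun_eq_iff pullback_conn_def christoffel_form_euclidean)

lemma curvature_euclidean: "curvature euclidean_mfd std_chart p u v w = 0"
  by (simp add: curvature_def curvature_op_def levi_civita_def christoffel_form_euclidean Dch_def o_def)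

lemma hs_norm_sq_euclidean:
  "hs_norm_sq M euclidean_mfd c std_chart f p = trace_g M c p (\<lambda>i j. \<partial> c i f p \<bullet> \<partial> c j f p)"
  by (simp add: hs_norm_sq_def differential_euclidean euclidean_mfd_def)

context riem_chart
begin

lemma tension_euclidean:
  assumes f: "smooth_in c W f" and p: "p \<in> W"
  shows "tension M euclidean_mfd c std_chart f p = lap f p"
  unfolding tension_def lap_def second_fundamental_form_def pullback_conn_euclidean differential_euclidean
    levi_civita_const
  by (simp add: Dch_expand[OF f p, of "vec_lambda _"])

lemma bitension_euclidean:
  assumes f: "smooth_in c W f" and p: "p \<in> W"
  shows "bitension M euclidean_mfd c std_chart f p = lap (lap f) p"
proof -
  have "bitension M euclidean_mfd c std_chart f p = lap (tension M euclidean_mfd c std_chart f) p"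
    unfolding bitension_def pullback_conn_euclidean curvature_euclidean conn_laplacian_eq_lap
    by (simp add: trace_g_def)
  also have "\<dots> = lap (lap f) p" by (rule lap_cong[OF tension_euclidean[OF f] p])
  finally show ?thesis .
qed

end


section \<open>Maps into the sphere\<close>

locale map_into_sphere = sphere_chart d for d :: "(real^'k::finite, 'n::finite) chart" +
  fixes M :: "('a, 'm::finite) riem_mfd" and c :: "('a, 'm) chart" and \<phi> :: "'a \<Rightarrow> real^'k"
  assumes M: "riemannian_manifold M" and c: "c \<in> atlas M"
    and smooth_map: "smooth_map M (sphere_mfd :: (real^'k, 'n) riem_mfd) \<phi>"
begin

abbreviation U where "U \<equiv> chart_dom c \<inter> \<phi> -` chart_dom d"

lemma chart_domain_U: "chart_domain c U"
proof -
  have ic: "is_chart (mtop M) c" using M c by (auto simp: riemannian_manifold_def)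
  let ?O = "{x \<in> topspace (mtop M). \<phi> x \<in> chart_dom d}"
  have "continuous_map (mtop M) (top_of_set (sphere 0 1)) \<phi>"
    using smooth_map by (simp add: smooth_map_def sphere_mfd_def)
  moreover have "openin (top_of_set (sphere 0 1)) (chart_dom d)"
    using is_chart by (simp add: is_chart_def)
  ultimately have "openin (mtop M) ?O" by (rule openin_continuous_map_preimage)
  moreover have "U = chart_dom c \<inter> ?O"
    using openin_subset[of "mtop M" "chart_dom c"] ic by (auto simp: is_chart_def)
  ultimately show ?thesis by (rule chart_domain_restrict[OF ic])
qed

sublocale m: riem_chart c U M
proof (rule riem_chart.intro[OF chart_domain_U], unfold_locales)
  interpret m: chart_domain c U by (rule chart_domain_U)
  have metric: "\<forall>p\<in>chart_dom c. transpose (rmetric M c p) = rmetric M c p \<and>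
      (\<forall>v. v \<noteq> 0 \<longrightarrow> v \<bullet> (rmetric M c p *v v) > 0)"
    using M c unfolding riemannian_manifold_def by blast
  have "smooth_on (rmetric M c \<circ> chart_inv c) (coords c ` chart_dom c)"
    using M c by (auto simp: riemannian_manifold_def)
  hence "smooth_in c U (rmetric M c)"
    unfolding smooth_in_def by (rule smooth_on_subset) auto
  thus "smooth_in c U (\<lambda>q. rmetric M c q $ i $ j)" for i j by (intro m.smooth_in_nth)
  show "transpose (rmetric M c p) = rmetric M c p" if "p \<in> U" for p
    using metric that by blast
  show "0 < v \<bullet> (rmetric M c p *v v)" if "p \<in> U" "v \<noteq> 0" for p v
    using metric that by blast
qed

abbreviation tr where "tr \<equiv> trace_g M c"

lemma maps_to: "\<phi> ` U \<subseteq> chart_dom d" by auto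

lemma smooth_coords: "smooth_in c U (\<lambda>q. coords d (\<phi> q))"
  using smooth_map c d by (simp add: smooth_map_def smooth_in_def o_def)

lemma smooth_\<phi>: "smooth_in c U \<phi>"
  using m.smooth_in_compose[OF chart_domain_axioms maps_to smooth_coords smooth_inclusion] .

lemmas smooth_D\<phi> = m.smooth_in_Dch[OF smooth_\<phi>]

lemma E_differential: "p \<in> U \<Longrightarrow> E (\<phi> p) (differential c d \<phi> p v) = Dch c \<phi> p v"
  using m.Dch_compose[OF chart_domain_axioms maps_to smooth_coords smooth_inclusion]
  by (simp add: differential_def o_def)

lemma smooth_differential: "smooth_in c U (\<lambda>q. differential c d \<phi> q v)"
  unfolding differential_def o_def by (rule m.smooth_in_Dch[OF smooth_coords])

lemma smooth_pullback_conn: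
  assumes "smooth_in c U \<sigma>"
  shows "smooth_in c U (pullback_conn S c d \<phi> i \<sigma>)"
  unfolding pullback_conn_def
proof (rule m.smooth_in_add[OF m.smooth_in_Dch[OF assms]], rule m.smooth_in_vec)
  fix k
  show "smooth_in c U (\<lambda>q. christoffel_form S d (\<phi> q) (differential c d \<phi> q (axis i 1)) (\<sigma> q) $ k)"
    unfolding christoffel_form_def vec_lambda_beta
    by (intro m.smooth_in_sum m.smooth_in_mult m.smooth_in_nth assms smooth_differential
      m.smooth_in_compose[OF chart_domain_axioms maps_to smooth_coords smooth_christoffel])
qed

lemma smooth_E\<sigma>: "smooth_in c U \<sigma> \<Longrightarrow> smooth_in c U (\<lambda>q. E (\<phi> q) (\<sigma> q))"
  by (rule smooth_E_compose[OF chart_domain_U maps_to smooth_coords])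

lemma E_pullback_conn:
  assumes "smooth_in c U \<sigma>" "p \<in> U"
  shows "E (\<phi> p) (pullback_conn S c d \<phi> i \<sigma> p) =
    \<partial> c i (\<lambda>q. E (\<phi> q) (\<sigma> q)) p + (\<partial> c i \<phi> p \<bullet> E (\<phi> p) (\<sigma> p)) *\<^sub>R \<phi> p"
  unfolding pullback_conn_def differential_def o_def
  by (rule E_pullback_connection[OF chart_domain_U maps_to smooth_coords assms])

lemma normal_D\<phi>: "p \<in> U \<Longrightarrow> \<phi> p \<bullet> Dch c \<phi> p v = 0"
  using E_differential[of p v] normal_E[of "\<phi> p"] by (metis IntD2 vimageD)

lemma linear_E\<phi>: "p \<in> U \<Longrightarrow> linear (E (\<phi> p))"
  using linear_E by auto

text \<open>The square \<open>|d\<phi>|\<^sup>2\<close> of the Hilbert--Schmidt norm, computed in the ambient space.\<close>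
definition en :: "'a \<Rightarrow> real" where
  "en p = tr p (\<lambda>i j. \<partial> c i \<phi> p \<bullet> \<partial> c j \<phi> p)"

lemma smooth_en: "smooth_in c U en"
  unfolding en_def by (intro m.smooth_trace m.smooth_in_inner smooth_D\<phi>)

lemma differential_levi_civita:
  "p \<in> U \<Longrightarrow> differential c d \<phi> p (levi_civita M c (\<lambda>_. axis i 1) (\<lambda>_. axis j 1) p) =
    (\<Sum>k\<in>UNIV. m.\<Gamma> p k i j *\<^sub>R differential c d \<phi> p (axis k 1))"
  unfolding differential_def o_def m.levi_civita_const
  by (subst m.Dch_expand[OF smooth_coords]) simp_all

lemma smooth_tension: "smooth_in c U (tension M S c d \<phi>)"
proof -
  have "smooth_in c U (\<lambda>q. tr q (\<lambda>i j. pullback_conn S c d \<phi> i (\<lambda>q. differential c d \<phi> q (axis j 1)) q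
      - (\<Sum>k\<in>UNIV. m.\<Gamma> q k i j *\<^sub>R differential c d \<phi> q (axis k 1))))"
    by (intro m.smooth_trace m.smooth_in_diff smooth_pullback_conn smooth_differential m.smooth_in_sum
        m.smooth_in_scaleR m.smooth_christoffel)
  then show ?thesis
    by (rule m.smooth_in_cong[rotated])
      (simp add: tension_def second_fundamental_form_def[abs_def] differential_levi_civita)
qed

text \<open>The projection in \<open>E_pullback_conn\<close> contributes \<open>\<langle>\<partial>\<^sub>i \<phi>, \<partial>\<^sub>j \<phi>\<rangle> \<phi>\<close> to the Hessian, and tracing gives the
  multiple of \<open>\<phi>\<close>.\<close>
lemma E_tension:
  assumes p: "p \<in> U"
  shows "E (\<phi> p) (tension M S c d \<phi> p) = m.lap \<phi> p + en p *\<^sub>R \<phi> p"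
proof -
  have d: "\<partial> c i (\<lambda>q. E (\<phi> q) (differential c d \<phi> q (axis j 1))) p = \<partial> c i (\<lambda>q. \<partial> c j \<phi> q) p" for i j
    by (rule m.Dch_cong[OF E_differential p])
  have "E (\<phi> p) (second_fundamental_form M S c d \<phi> p i j) =
    (\<partial> c i (\<lambda>q. \<partial> c j \<phi> q) p - (\<Sum>k\<in>UNIV. m.\<Gamma> p k i j *\<^sub>R \<partial> c k \<phi> p)) + (\<partial> c i \<phi> p \<bullet> \<partial> c j \<phi> p) *\<^sub>R \<phi> p" for i j
    unfolding second_fundamental_form_def differential_levi_civita[OF p] linear_diff[OF linear_E\<phi>[OF p]]
      linear_sum[OF linear_E\<phi>[OF p]] linear_scale[OF linear_E\<phi>[OF p]]
      E_pullback_conn[OF smooth_differential p] d E_differential[OF p] by simp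
  thus ?thesis
    unfolding tension_def trace_g_linear[OF linear_E\<phi>[OF p]]
    by (simp add: trace_g_add trace_g_scaleR_left m.lap_def en_def)
qed

text \<open>Differentiate \<open>\<langle>\<partial>\<^sub>j \<phi>, \<phi>\<rangle> = 0\<close> and take the trace.\<close>
lemma inner_lap_\<phi>: "p \<in> U \<Longrightarrow> m.lap \<phi> p \<bullet> \<phi> p = - en p"
proof -
  assume p: "p \<in> U"
  have n: "\<partial> c j \<phi> q \<bullet> \<phi> q = 0" if "q \<in> U" for j q using normal_D\<phi>[OF that] by (simp add: inner_commute)
  have "\<partial> c i (\<lambda>q. \<partial> c j \<phi> q) p \<bullet> \<phi> p = - (\<partial> c i \<phi> p \<bullet> \<partial> c j \<phi> p)" for i j
  proof -
    have "0 = \<partial> c i (\<lambda>q. \<partial> c j \<phi> q \<bullet> \<phi> q) p" by (subst m.Dch_cong[OF n p]) simp_all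
    also have "\<dots> = \<partial> c j \<phi> p \<bullet> \<partial> c i \<phi> p + \<partial> c i (\<lambda>q. \<partial> c j \<phi> q) p \<bullet> \<phi> p"
      by (rule m.Dch_inner[OF smooth_D\<phi> smooth_\<phi> p])
    finally show ?thesis by (simp add: inner_commute)
  qed
  thus ?thesis
    unfolding m.lap_def trace_g_linear[OF bounded_linear.linear[OF bounded_linear_inner_left]]
    by (simp add: inner_diff_left inner_sum_left n[OF p] trace_g_uminus en_def)
qed

text \<open>Take two covariant derivatives of \<open>T = t + e \<phi>\<close> by \<open>E_pullback_conn\<close> and subtract the curvature term.
  The tangential terms \<open>\<theta>\<^sub>j \<partial>\<^sub>i \<phi>\<close> that arise from differentiating \<open>\<phi>\<close> cancel against those of the Gauss
  equation, and only multiples of \<open>\<phi>\<close> and of \<open>T\<close> are left besides the Laplacian of \<open>T\<close>.\<close>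
lemma E_bitension:
  assumes p: "p \<in> U"
  defines "\<theta> \<equiv> (\<lambda>q X. Dch c \<phi> q X \<bullet> tension M euclidean_mfd c std_chart \<phi> q)"
  shows "E (\<phi> p) (bitension M S c d \<phi> p) =
    m.lap (m.lap \<phi>) p + (2 * en p) *\<^sub>R m.lap \<phi> p
      + (m.lap en p + 2 * divergence M c (sharp M c \<theta>) p - (norm (m.lap \<phi> p))\<^sup>2 + 2 * (en p)\<^sup>2) *\<^sub>R \<phi> p
      + 2 *\<^sub>R Dch c \<phi> p (grad M c en p)"
proof -
  note lin = linear_E\<phi>[OF p]
  define t where "t = m.lap \<phi>"
  define \<tau> where "\<tau> = tension M S c d \<phi>"
  define T where "T q = E (\<phi> q) (\<tau> q)" for q
  define \<alpha> where "\<alpha> j q = \<partial> c j \<phi> q \<bullet> T q" for j q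
  define \<delta> where "\<delta> = divergence M c (sharp M c \<theta>) p"
  have st: "smooth_in c U t" unfolding t_def by (rule m.smooth_lap[OF smooth_\<phi>])
  have s\<tau>: "smooth_in c U \<tau>" unfolding \<tau>_def by (rule smooth_tension)
  have sT: "smooth_in c U T" unfolding T_def by (rule smooth_E\<sigma>[OF s\<tau>])
  have s\<alpha>: "smooth_in c U (\<alpha> j)" for j unfolding \<alpha>_def by (intro m.smooth_in_inner smooth_D\<phi> sT)
  have T: "T q = t q + en q *\<^sub>R \<phi> q" if "q \<in> U" for q
    unfolding T_def \<tau>_def t_def by (rule E_tension[OF that])
  have \<theta>: "\<theta> q (axis j 1) = \<alpha> j q" if "q \<in> U" for j q
    unfolding \<theta>_def \<alpha>_def T[OF that] t_def m.tension_euclidean[OF smooth_\<phi> that]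
    using normal_D\<phi>[OF that] by (simp add: inner_add_right inner_commute)
  have s\<theta>: "smooth_in c U (\<lambda>q. \<theta> q (axis j 1))" for j
    using s\<alpha>[of j] by (rule m.smooth_in_cong[rotated]) (rule \<theta>[symmetric])
  have \<delta>1: "\<delta> = tr p (\<lambda>i j. \<partial> c i (\<alpha> j) p - (\<Sum>k\<in>UNIV. m.\<Gamma> p k i j * \<alpha> k p))"
  proof -
    have "\<partial> c i (\<lambda>q. \<theta> q (axis j 1)) p = \<partial> c i (\<alpha> j) p" for i j
      by (rule m.Dch_cong[OF \<theta> p])
    thus ?thesis
      unfolding \<delta>_def using m.divergence_sharp[of p \<theta>, OF p s\<theta>] \<theta>[OF p] by simp
  qed
  define \<beta> where "\<beta> = tr p (\<lambda>i j. \<partial> c i \<phi> p \<bullet> \<partial> c j T p)"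
  \<comment> \<open>The product rule for \<open>\<theta>\<^sub>j = \<langle>\<partial>\<^sub>j \<phi>, T\<rangle>\<close>.\<close>
  have \<delta>2: "\<delta> = t p \<bullet> T p + \<beta>"
  proof -
    have "\<partial> c i (\<alpha> j) p = \<partial> c j \<phi> p \<bullet> \<partial> c i T p + \<partial> c i (\<lambda>q. \<partial> c j \<phi> q) p \<bullet> T p" for i j
      unfolding \<alpha>_def by (rule m.Dch_inner[OF smooth_D\<phi> sT p])
    hence "\<delta> = tr p (\<lambda>i j. \<partial> c j \<phi> p \<bullet> \<partial> c i T p +
        (\<partial> c i (\<lambda>q. \<partial> c j \<phi> q) p - (\<Sum>k\<in>UNIV. m.\<Gamma> p k i j *\<^sub>R \<partial> c k \<phi> p)) \<bullet> T p)"
      unfolding \<delta>1 \<alpha>_def by (simp add: inner_diff_left inner_sum_left add_diff_eq)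
    also have "\<dots> = \<beta> + t p \<bullet> T p"
      unfolding trace_g_add \<beta>_def t_def m.lap_def
        trace_g_linear[OF bounded_linear.linear[OF bounded_linear_inner_left]]
      using m.trace_g_swap[OF p, of "\<lambda>i j. \<partial> c i \<phi> p \<bullet> \<partial> c j T p"] by simp
    finally show ?thesis by simp
  qed
  \<comment> \<open>The image of the covariant derivative of the tension field.\<close>
  define A where "A j q = \<partial> c j T q + \<alpha> j q *\<^sub>R \<phi> q" for j q
  have EP: "E (\<phi> q) (pullback_conn S c d \<phi> j \<tau> q) = A j q" if "q \<in> U" for j q
    unfolding A_def \<alpha>_def T_def by (rule E_pullback_conn[OF s\<tau> that])
  have DA: "\<partial> c i (A j) p = \<partial> c i (\<lambda>q. \<partial> c j T q) p + \<partial> c i (\<alpha> j) p *\<^sub>R \<phi> p + \<alpha> j p *\<^sub>R \<partial> c i \<phi> p" for i j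
  proof -
    have "\<partial> c i (A j) p = \<partial> c i (\<lambda>q. \<partial> c j T q) p + \<partial> c i (\<lambda>q. \<alpha> j q *\<^sub>R \<phi> q) p"
      unfolding A_def by (intro m.Dch_add m.smooth_in_scaleR m.smooth_in_Dch sT s\<alpha> smooth_\<phi> p)
    thus ?thesis unfolding m.Dch_scaleR[OF s\<alpha> smooth_\<phi> p] by simp
  qed
  have DEP: "\<partial> c i (\<lambda>q. E (\<phi> q) (pullback_conn S c d \<phi> j \<tau> q)) p = \<partial> c i (A j) p" for i j
    by (rule m.Dch_cong[OF EP p])
  have EPP: "E (\<phi> p) (pullback_conn S c d \<phi> i (pullback_conn S c d \<phi> j \<tau>) p) =
      \<partial> c i (\<lambda>q. \<partial> c j T q) p + \<partial> c i (\<alpha> j) p *\<^sub>R \<phi> p + \<alpha> j p *\<^sub>R \<partial> c i \<phi> p + (\<partial> c i \<phi> p \<bullet> \<partial> c j T p) *\<^sub>R \<phi> p" for i j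
    unfolding E_pullback_conn[OF smooth_pullback_conn[OF s\<tau>] p] DEP EP[OF p] DA
    using normal_D\<phi>[OF p] by (simp add: A_def inner_add_right inner_commute)
  have 1: "E (\<phi> p) (- conn_laplacian M c (pullback_conn S c d \<phi>) \<tau> p) =
      m.lap T p + \<delta> *\<^sub>R \<phi> p + tr p (\<lambda>i j. \<alpha> j p *\<^sub>R \<partial> c i \<phi> p) + \<beta> *\<^sub>R \<phi> p"
  proof -
    have "E (\<phi> p) (- conn_laplacian M c (pullback_conn S c d \<phi>) \<tau> p) =
      tr p (\<lambda>i j. (\<partial> c i (\<lambda>q. \<partial> c j T q) p - (\<Sum>k\<in>UNIV. m.\<Gamma> p k i j *\<^sub>R \<partial> c k T p))
        + (\<partial> c i (\<alpha> j) p - (\<Sum>k\<in>UNIV. m.\<Gamma> p k i j * \<alpha> k p)) *\<^sub>R \<phi> p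
        + \<alpha> j p *\<^sub>R \<partial> c i \<phi> p + (\<partial> c i \<phi> p \<bullet> \<partial> c j T p) *\<^sub>R \<phi> p)"
      unfolding conn_laplacian_def minus_minus trace_g_linear[OF lin] linear_diff[OF lin] linear_sum[OF lin]
        linear_scale[OF lin] EPP EP[OF p] A_def
      by (rule arg_cong[of _ _ "tr p"], intro ext)
        (simp add: scaleR_add_right sum.distrib scaleR_diff_left scaleR_sum_left)
    thus ?thesis
      unfolding trace_g_add trace_g_scaleR_left \<delta>1[symmetric] \<beta>_def[symmetric] m.lap_def[symmetric] .
  qed
  have p': "\<phi> p \<in> chart_dom d" using p by simp
  \<comment> \<open>The curvature term; its first part cancels the third summand of the Laplacian.\<close>
  have 2: "E (\<phi> p) (tr p (\<lambda>i j. curvature S d (\<phi> p) (differential c d \<phi> p (axis i 1)) (\<tau> p)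
      (differential c d \<phi> p (axis j 1)))) = tr p (\<lambda>i j. \<alpha> j p *\<^sub>R \<partial> c i \<phi> p) - en p *\<^sub>R T p"
    unfolding trace_g_linear[OF lin] E_curvature[OF p'] E_differential[OF p] trace_g_diff trace_g_scaleR_left
    by (simp add: T_def \<alpha>_def en_def inner_commute)
  have 3: "E (\<phi> p) (bitension M S c d \<phi> p) = m.lap T p + (\<delta> + \<beta>) *\<^sub>R \<phi> p + en p *\<^sub>R T p"
    unfolding bitension_def \<tau>_def[symmetric] linear_diff[OF lin] 1 2 by (simp add: scaleR_add_left)
  have 4: "m.lap T p = m.lap t p + (en p *\<^sub>R t p + m.lap en p *\<^sub>R \<phi> p + 2 *\<^sub>R Dch c \<phi> p (grad M c en p))"
  proof -
    have "m.lap T p = m.lap (\<lambda>q. t q + en q *\<^sub>R \<phi> q) p" by (rule m.lap_cong[OF T p])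
    also have "\<dots> = m.lap t p + m.lap (\<lambda>q. en q *\<^sub>R \<phi> q) p"
      by (rule m.lap_add[OF st m.smooth_in_scaleR[OF smooth_en smooth_\<phi>] p])
    finally show ?thesis
      unfolding m.lap_scaleR[OF smooth_en smooth_\<phi> p] m.differential_grad[OF smooth_\<phi> p]
      by (simp only: t_def)
  qed
  have "t p \<bullet> T p = (norm (t p))\<^sup>2 - (en p)\<^sup>2"
    unfolding T[OF p] using inner_lap_\<phi>[OF p]
    by (simp add: inner_add_right t_def power2_norm_eq_inner) (simp add: power2_eq_square)
  hence 5: "\<beta> = \<delta> - (norm (t p))\<^sup>2 + (en p)\<^sup>2" using \<delta>2 by simp
  show ?thesis
    unfolding 3 4 5 T[OF p] t_def[symmetric] \<delta>_def[symmetric]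
    by (simp add: vec_eq_iff power2_eq_square algebra_simps)
qed

text \<open>The operators for maps into Euclidean space reduce to \<open>lap\<close>, which has the opposite sign of
  \<open>laplacian\<close>.\<close>
lemma pde_eq_E_bitension:
  assumes p: "p \<in> U"
  defines "\<tau> \<equiv> tension M euclidean_mfd c std_chart \<phi>"
    and "e \<equiv> hs_norm_sq M euclidean_mfd c std_chart \<phi>"
    and "d\<phi> \<equiv> differential c std_chart \<phi>"
  shows "bitension M euclidean_mfd c std_chart \<phi> p + (2 * e p) *\<^sub>R \<tau> p
      + (- laplacian M c e p + 2 * divergence M c (sharp M c (\<lambda>q X. d\<phi> q X \<bullet> \<tau> q)) p
         - (norm (\<tau> p))\<^sup>2 + 2 * (e p)\<^sup>2) *\<^sub>R \<phi> p
      + 2 *\<^sub>R d\<phi> p (grad M c e p) = E (\<phi> p) (bitension M S c d \<phi> p)"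
proof -
  have e: "e = en" by (simp add: fun_eq_iff e_def en_def hs_norm_sq_euclidean)
  show ?thesis
    unfolding E_bitension[OF p] e d\<phi>_def \<tau>_def laplacian_def m.conn_laplacian_eq_lap differential_euclidean
      m.bitension_euclidean[OF smooth_\<phi> p] m.tension_euclidean[OF smooth_\<phi> p] by simp
qed

end

theorem theorem2p6:
  fixes M :: "('a, 'm::finite) riem_mfd" and \<phi> :: "'a \<Rightarrow> real^'k::finite"
  assumes dim: "CARD('k) = CARD('n::finite) + 1"
    and M: "riemannian_manifold M"
    and smooth: "smooth_map M (sphere_mfd :: (real^'k, 'n) riem_mfd) \<phi>"
  shows "biharmonic M (sphere_mfd :: (real^'k, 'n) riem_mfd) \<phi> \<longleftrightarrow>
    (let \<iota> = (\<lambda>x :: real^'k. x); \<psi> = \<iota> \<circ> \<phi> in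
     \<forall>c\<in>atlas M. \<forall>p\<in>chart_dom c.
       let d\<psi> = differential c std_chart \<psi>;
           \<tau> = tension M euclidean_mfd c std_chart \<psi>;
           \<tau>2 = bitension M euclidean_mfd c std_chart \<psi>;
           e = hs_norm_sq M euclidean_mfd c std_chart \<psi>;
           \<theta> = (\<lambda>q X. d\<psi> q X \<bullet> \<tau> q)
       in \<tau>2 p + (2 * e p) *\<^sub>R \<tau> p
          + (- laplacian M c e p + 2 * divergence M c (sharp M c \<theta>) p
               - (norm (\<tau> p))\<^sup>2 + 2 * (e p)\<^sup>2) *\<^sub>R \<psi> p
          + 2 *\<^sub>R d\<psi> p (grad M c e p) = 0)"
proof -
  \<comment> \<open>The left-hand side of the equation, with the inclusion of the sphere elided.\<close>
  define lhs where "lhs c p = bitension M euclidean_mfd c std_chart \<phi> p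
      + (2 * hs_norm_sq M euclidean_mfd c std_chart \<phi> p) *\<^sub>R tension M euclidean_mfd c std_chart \<phi> p
      + (- laplacian M c (hs_norm_sq M euclidean_mfd c std_chart \<phi>) p
         + 2 * divergence M c (sharp M c (\<lambda>q X. differential c std_chart \<phi> q X \<bullet> tension M euclidean_mfd c std_chart \<phi> q)) p
         - (norm (tension M euclidean_mfd c std_chart \<phi> p))\<^sup>2 + 2 * (hs_norm_sq M euclidean_mfd c std_chart \<phi> p)\<^sup>2) *\<^sub>R \<phi> p
      + 2 *\<^sub>R differential c std_chart \<phi> p (grad M c (hs_norm_sq M euclidean_mfd c std_chart \<phi>) p)" for c p
  have key: "lhs c p = 0 \<longleftrightarrow> bitension M (sphere_mfd :: (real^'k, 'n) riem_mfd) c d \<phi> p = 0"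
    if "c \<in> atlas M" "d \<in> atlas (sphere_mfd :: (real^'k, 'n) riem_mfd)" "p \<in> chart_dom c" "\<phi> p \<in> chart_dom d"
    for c p and d :: "(real^'k, 'n) chart"
  proof -
    interpret map_into_sphere d M c \<phi>
      by unfold_locales (use dim M smooth that in auto)
    have p: "p \<in> U" using that by simp
    have "lhs c p = E (\<phi> p) (bitension M S c d \<phi> p)"
      unfolding lhs_def by (rule pde_eq_E_bitension[OF p])
    thus ?thesis
      using linear_injective_0[OF linear_E\<phi>[OF p]] inj_E[OF that(4)] linear_0[OF linear_E\<phi>[OF p]] by auto
  qed
  have chart: "\<exists>d\<in>atlas (sphere_mfd :: (real^'k, 'n) riem_mfd). \<phi> p \<in> chart_dom d"
    if c: "c \<in> atlas M" "p \<in> chart_dom c" for c p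
  proof (rule sphere_chart_exists[OF dim])
    have "p \<in> topspace (mtop M)" using M c by (auto simp: riemannian_manifold_def)
    moreover have "continuous_map (mtop M) (top_of_set (sphere 0 1)) \<phi>"
      using smooth by (simp add: smooth_map_def sphere_mfd_def)
    ultimately show "\<phi> p \<in> sphere 0 1" by (auto simp: continuous_map_def)
  qed
  have "biharmonic M (sphere_mfd :: (real^'k, 'n) riem_mfd) \<phi> \<longleftrightarrow> (\<forall>c\<in>atlas M. \<forall>p\<in>chart_dom c. lhs c p = 0)"
    unfolding biharmonic_def using key chart by blast
  thus ?thesis by (simp add: lhs_def Let_def o_def)
qed

end
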